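(* Let $k\in\mathbb Z_+$ and $f\in\mathcal L_k$. If $I_k^e(f)<\infty$ a.s., then $f\in L_+^\alpha(\mu^k)$, i.e. $\int_{E^k}f^\alpha\,d\mu^k<\infty$.
   Context: $\mathbb Z_+=\{1,2,\dots\}$, $\alpha\in(0,\infty)$, $\bigvee$ denotes supremum. $(E,\mathcal E)$ is a Borel space (there is a measurable bijection, with measurable inverse, onto a Borel subset of $[0,1]$) and $\mu$ is a nonzero $\sigma$-finite measure on it. $M_\alpha=(M_\alpha(A))_{A\in\mathcal E}$ is an independently scattered $\alpha$-Fréchet random sup measure with control measure $\mu$: $[0,\infty]$-valued random variables such that (i) $M_\alpha(A_1),\dots,M_\alpha(A_n)$ are independent for disjoint $A_i\in\mathcal E$; (ii) $\mathbb P(M_\alpha(A)\le x)=\exp\{-\mu(A)x^{-\alpha}\}$, $x\in(0,\infty)$ (so $M_\alpha(A)=\infty$ a.s. if $\mu(A)=\infty$); (iii) $M_\alpha(\bigcup_{j\ge1}A_j)=\bigvee_{j\ge1}M_\alpha(A_j)$ a.s. for $A_j\in\mathcal E$. Off-diagonal space: $D^{(k)}=\{(x_1,\dots,x_k)\in E^k:x_i=x_j\text{ for some }i\ne j\}$, $E^{(k)}=E^k\setminus D^{(k)}$, $\mathcal E^{(k)}=\{A\cap E^{(k)}:A\in\mathcal E^k\}$. $\mathcal L_k$ is the class of measurable $f:E^k\to[0,\infty]$ vanishing on $D^{(k)}$. Product random sup measure $M_\alpha^{(k)}$ on $\mathcal E^{(k)}$: when the control measure is finite, $M_\alpha^{(k)}(A_1\times\cdots\times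 A_k)=M_\alpha(A_1)\cdots M_\alpha(A_k)$ for pairwise disjoint $A_i\in\mathcal E$; $M_\alpha^{(k)}(\bigcup_{i=1}^mB_i)=\bigvee_{i=1}^mM_\alpha^{(k)}(B_i)$ for such off-diagonal rectangles $B_i$; and for $A\in\mathcal E^{(k)}$, $M_\alpha^{(k)}(A)$ is the $L^\gamma$-limit ($\gamma\in(0,\alpha)$) of $M_\alpha^{(k)}(A_n)$ for finite unions $A_n$ of off-diagonal rectangles with $\mu^k(A_n\Delta A)\to0$. For $\sigma$-finite $\mu$, take $E_n\uparrow E$ with $\mu(E_n)\in(0,\infty)$, let $M_{\alpha,E_n}(\cdot)=M_\alpha(\cdot\cap E_n)$ and $M_\alpha^{(k)}(A)=\bigvee_nM_{\alpha,E_n}^{(k)}(A)$. All of this is a.s. independent of choices. Multiple extremal integral: for simple $f=\sum_{i=1}^Na_i\mathbf 1_{A_i}$ with $a_i\in(0,\infty)$ and disjoint $A_i\in\mathcal E^{(k)}$, $I_k^e(f)=\bigvee_{i=1}^Na_iM_\alpha^{(k)}(A_i)$. For $f\in\mathcal L_k$, $I_k^e(f)$ is the a.s. limit of $I_k^e(f_n)$ for any such simple $f_n\le f_{n+1}$ with $f_n\to f$ $\mu^k$-a.e. (a.s. independent of the choice). Equivalently in law (LePage representation), jointly over $f\in\mathcal L_k$ and $k\in\mathbb Z_+$ and for any probability measure $m$ equivalent to $\mu$ with $\psi=d\mu/dm\in(0,\infty)$ $m$-a.e., $I_k^e(f)\overset d=\bigvee_{\boldsymbol j}f(T_{j_1},\dots,T_{j_k})\prod_{r=1}^k\Gamma_{j_r}^{-1/\alpha}\psi(T_{j_r})^{1/\alpha}$,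 the supremum being over $\boldsymbol j\in\mathbb Z_+^k$ with distinct entries, $(\Gamma_i)$ the arrival times of a standard Poisson process, and $(T_i)$ i.i.d. with law $m$ independent of $(\Gamma_i)$. *)

theory Defs
  imports "HOL-Probability.Probability"
begin

text \<open>Only used with positive exponents; \<open>powr\<close> is not available on \<^typ>\<open>ennreal\<close>.\<close>

definition ennpowr :: "ennreal \<Rightarrow> real \<Rightarrow> ennreal" where
  "ennpowr x a = (if x = \<infinity> then \<infinity> else ennreal (enn2real x powr a))"

text \<open>Since subtraction on \<^typ>\<open>ennreal\<close> is truncated, \<open>(X - Y) + (Y - X)\<close> is \<open>\<bar>X - Y\<bar>\<close>; it is
  \<open>\<infinity>\<close> as soon as one of the two values is (also for \<open>\<infinity> - \<infinity>\<close>).\<close>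

definition Lgamma_tendsto ::
  "real \<Rightarrow> 'w measure \<Rightarrow> (nat \<Rightarrow> 'w \<Rightarrow> ennreal) \<Rightarrow> ('w \<Rightarrow> ennreal) \<Rightarrow> bool" where
  "Lgamma_tendsto \<gamma> P X Y \<longleftrightarrow>
     (\<lambda>n. \<integral>\<^sup>+ \<omega>. ennpowr ((X n \<omega> - Y \<omega>) + (Y \<omega> - X n \<omega>)) \<gamma> \<partial>P) \<longlonglongrightarrow> 0"

definition is_borel_space :: "'a measure \<Rightarrow> bool" where
  "is_borel_space E \<longleftrightarrow>
     (\<exists>B \<phi> \<psi>. B \<in> sets (borel :: real measure) \<and> B \<subseteq> {0..1} \<and>
        \<phi> \<in> measurable E (restrict_space borel B) \<and>
        \<psi> \<in> measurable (restrict_space borel B) E \<and>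
        (\<forall>x\<in>space E. \<psi> (\<phi> x) = x) \<and> (\<forall>y\<in>B. \<phi> (\<psi> y) = y))"

definition frechet_rsm ::
  "real \<Rightarrow> 'a measure \<Rightarrow> 'w measure \<Rightarrow> ('a set \<Rightarrow> 'w \<Rightarrow> ennreal) \<Rightarrow> bool" where
  "frechet_rsm \<alpha> \<mu> P M \<longleftrightarrow>
     prob_space P \<and>
     (\<forall>A\<in>sets \<mu>. M A \<in> borel_measurable P) \<and>
     (\<forall>(n::nat) A. (\<forall>i<n. A i \<in> sets \<mu>) \<and> disjoint_family_on A {..<n} \<longrightarrow>
        prob_space.indep_vars P (\<lambda>_. borel) (\<lambda>i. M (A i)) {..<n}) \<and>
     (\<forall>A\<in>sets \<mu>. \<forall>x>0.
        measure P {\<omega>\<in>space P. M A \<omega> \<le> ennreal x} =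
          (if emeasure \<mu> A = \<infinity> then 0 else exp (- (measure \<mu> A * x powr (- \<alpha>))))) \<and>
     (\<forall>A::nat \<Rightarrow> 'a set. range A \<subseteq> sets \<mu> \<longrightarrow>
        (AE \<omega> in P. M (\<Union>j. A j) \<omega> = (SUP j. M (A j) \<omega>)))"

text \<open>The space \<open>E\<^sup>k\<close> consists of the extensional functions on \<open>{..<k}\<close>.\<close>

abbreviation power_measure :: "nat \<Rightarrow> 'a measure \<Rightarrow> (nat \<Rightarrow> 'a) measure" where
  "power_measure k \<mu> \<equiv> PiM {..<k} (\<lambda>_. \<mu>)"

definition diag_space :: "nat \<Rightarrow> 'a measure \<Rightarrow> (nat \<Rightarrow> 'a) set" where
  "diag_space k \<mu> = {x \<in> space (power_measure k \<mu>). \<exists>i<k. \<exists>j<k. i \<noteq> j \<and> x i = x j}"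

definition offdiag_space :: "nat \<Rightarrow> 'a measure \<Rightarrow> (nat \<Rightarrow> 'a) set" where
  "offdiag_space k \<mu> = space (power_measure k \<mu>) - diag_space k \<mu>"

definition offdiag_sets :: "nat \<Rightarrow> 'a measure \<Rightarrow> (nat \<Rightarrow> 'a) set set" where
  "offdiag_sets k \<mu> = {A \<inter> offdiag_space k \<mu> | A. A \<in> sets (power_measure k \<mu>)}"

definition offdiag_functions :: "nat \<Rightarrow> 'a measure \<Rightarrow> ((nat \<Rightarrow> 'a) \<Rightarrow> ennreal) set" where
  "offdiag_functions k \<mu> =
     {f \<in> borel_measurable (power_measure k \<mu>). \<forall>x\<in>diag_space k \<mu>. f x = 0}"

definition offdiag_rects :: "nat \<Rightarrow> 'a measure \<Rightarrow> (nat \<Rightarrow> 'a) set set" where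
  "offdiag_rects k \<mu> =
     {PiE {..<k} A | A. (\<forall>i<k. A i \<in> sets \<mu>) \<and> disjoint_family_on A {..<k}}"

definition offdiag_rect_unions :: "nat \<Rightarrow> 'a measure \<Rightarrow> (nat \<Rightarrow> 'a) set set" where
  "offdiag_rect_unions k \<mu> =
     {(\<Union>i<m. B i) | (m::nat) B. \<forall>i<m. B i \<in> offdiag_rects k \<mu>}"

text \<open>The product random sup measure and the multiple extremal integral are only determined up to
  almost sure equality, so they are described by predicates holding for all their versions.
  The auxiliary choices (approximating sets, exhausting sequence, approximating simple
  functions) do not affect the result almost surely; the predicates ask for some choice.\<close>

definition product_rsm_finite ::
  "real \<Rightarrow> nat \<Rightarrow> 'a measure \<Rightarrow> 'w measure \<Rightarrow> ('a set \<Rightarrow> 'w \<Rightarrow> ennreal)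
    \<Rightarrow> ((nat \<Rightarrow> 'a) set \<Rightarrow> 'w \<Rightarrow> ennreal) \<Rightarrow> bool" where
  "product_rsm_finite \<alpha> k \<mu> P M N \<longleftrightarrow>
     (\<forall>A\<in>offdiag_sets k \<mu>. N A \<in> borel_measurable P) \<and>
     (\<forall>A. (\<forall>i<k. A i \<in> sets \<mu>) \<and> disjoint_family_on A {..<k} \<longrightarrow>
        (AE \<omega> in P. N (PiE {..<k} A) \<omega> = (\<Prod>i<k. M (A i) \<omega>))) \<and>
     (\<forall>(m::nat) B. (\<forall>i<m. B i \<in> offdiag_rects k \<mu>) \<longrightarrow>
        (AE \<omega> in P. N (\<Union>i<m. B i) \<omega> = (SUP i\<in>{..<m}. N (B i) \<omega>))) \<and>
     (\<forall>A\<in>offdiag_sets k \<mu>. \<exists>C::nat \<Rightarrow> (nat \<Rightarrow> 'a) set.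
        range C \<subseteq> offdiag_rect_unions k \<mu> \<and>
        (\<lambda>n. emeasure (power_measure k \<mu>) ((C n - A) \<union> (A - C n))) \<longlonglongrightarrow> 0 \<and>
        (\<forall>\<gamma>. 0 < \<gamma> \<and> \<gamma> < \<alpha> \<longrightarrow> Lgamma_tendsto \<gamma> P (\<lambda>n. N (C n)) (N A)))"

text \<open>The restriction of \<open>\<mu>\<close> to \<open>E\<^sub>n\<close> is kept as a measure on all of \<open>E\<close>.\<close>

definition product_rsm ::
  "real \<Rightarrow> nat \<Rightarrow> 'a measure \<Rightarrow> 'w measure \<Rightarrow> ('a set \<Rightarrow> 'w \<Rightarrow> ennreal)
    \<Rightarrow> ((nat \<Rightarrow> 'a) set \<Rightarrow> 'w \<Rightarrow> ennreal) \<Rightarrow> bool" where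
  "product_rsm \<alpha> k \<mu> P M N \<longleftrightarrow>
     (\<forall>A\<in>offdiag_sets k \<mu>. N A \<in> borel_measurable P) \<and>
     (\<exists>(E :: nat \<Rightarrow> 'a set) K.
        range E \<subseteq> sets \<mu> \<and> incseq E \<and> (\<Union>n. E n) = space \<mu> \<and>
        (\<forall>n. 0 < emeasure \<mu> (E n) \<and> emeasure \<mu> (E n) < \<infinity>) \<and>
        (\<forall>n. product_rsm_finite \<alpha> k (density \<mu> (indicator (E n))) P (\<lambda>A. M (A \<inter> E n)) (K n)) \<and>
        (\<forall>A\<in>offdiag_sets k \<mu>. AE \<omega> in P. N A \<omega> = (SUP n. K n A \<omega>)))"

definition simple_extremal_integral ::
  "nat \<Rightarrow> 'a measure \<Rightarrow> 'w measure \<Rightarrow> ((nat \<Rightarrow> 'a) set \<Rightarrow> 'w \<Rightarrow> ennreal)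
    \<Rightarrow> ((nat \<Rightarrow> 'a) \<Rightarrow> ennreal) \<Rightarrow> ('w \<Rightarrow> ennreal) \<Rightarrow> bool" where
  "simple_extremal_integral k \<mu> P N f X \<longleftrightarrow>
     X \<in> borel_measurable P \<and>
     (\<exists>(m::nat) (a :: nat \<Rightarrow> real) A.
        (\<forall>i<m. 0 < a i \<and> A i \<in> offdiag_sets k \<mu>) \<and> disjoint_family_on A {..<m} \<and>
        (\<forall>x\<in>space (power_measure k \<mu>). f x = (\<Sum>i<m. ennreal (a i) * indicator (A i) x)) \<and>
        (AE \<omega> in P. X \<omega> = (SUP i\<in>{..<m}. ennreal (a i) * N (A i) \<omega>)))"

definition extremal_integral ::
  "nat \<Rightarrow> 'a measure \<Rightarrow> 'w measure \<Rightarrow> ((nat \<Rightarrow> 'a) set \<Rightarrow> 'w \<Rightarrow> ennreal)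
    \<Rightarrow> ((nat \<Rightarrow> 'a) \<Rightarrow> ennreal) \<Rightarrow> ('w \<Rightarrow> ennreal) \<Rightarrow> bool" where
  "extremal_integral k \<mu> P N f X \<longleftrightarrow>
     X \<in> borel_measurable P \<and>
     (\<exists>fn Xn.
        (\<forall>n. simple_extremal_integral k \<mu> P N (fn n) (Xn n)) \<and>
        (\<forall>n. \<forall>x\<in>space (power_measure k \<mu>). fn n x \<le> fn (Suc n) x) \<and>
        (AE x in power_measure k \<mu>. (\<lambda>n. fn n x) \<longlonglongrightarrow> f x) \<and>
        (AE \<omega> in P. (\<lambda>n. Xn n \<omega>) \<longlonglongrightarrow> X \<omega>))"

end

theory Submission
  imports Defs
begin

text \<open>
  Finiteness of \<open>I\<close> gives one level \<open>l\<close> that the integrals of all but finitely many of the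
  approximating simple functions exceed with probability less than \<open>2^-k\<close>
  (\<open>tight_of_AE_tendsto_finite\<close>). The proof shows that
  any simple \<open>f\<close> whose integral exceeds \<open>l\<close> with so small a probability satisfies
  \<open>\<integral>f^\<alpha> d\<mu>^k \<le> (4k)^k (l + 1)^\<alpha>\<close> (\<open>integral_simple_le\<close>). The bound is the same for all
  of these approximating functions, so Fatou's lemma carries it to the limit function.

  For a simple function the integral dominates the one taken over a piece \<open>E n\<close> of finite measure,
  and there it is close in probability to a maximum of products \<open>a \<cdot> M (R 0) \<cdots> M (R (k - 1))\<close>
  over finitely many off-diagonal rectangles. Cutting the sides of all the rectangles into common
  atoms \<open>B 0, \<dots>, B (p - 1)\<close> bounds this maximum from below by
  \<open>max w(j) M (B (j 0)) \<cdots> M (B (j (k - 1)))\<close>, where \<open>j\<close> ranges over injective index tuples, while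
  \<open>\<integral>f^\<alpha> d\<mu>^k\<close> becomes \<open>\<Sum> w(j)^\<alpha> \<mu> (B (j 0)) \<cdots> \<mu> (B (j (k - 1)))\<close>
  (\<open>integral_rect_step_le\<close>). The variables \<open>Y i = M (B i)^\<alpha>\<close> are independent with
  \<open>P (Y i \<le> y) = exp (- \<mu> (B i) / y)\<close>. What is left is an inequality for such variables
  (\<open>sum_le_of_prob_max_less\<close>): if the maximum of \<open>v(j) Y (j 0) \<cdots> Y (j (k - 1))\<close> exceeds \<open>L\<close>
  with probability less than \<open>2^-k\<close>, then the sum of \<open>v(j) m (j 0) \<cdots> m (j (k - 1))\<close> is at most
  \<open>(4k)^k L\<close>, where \<open>m i\<close> is the scale of \<open>Y i\<close>.

  That inequality has two ingredients. Decoupling: colour the indices with \<open>k\<close> colours; an injective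
  tuple \<open>j\<close> has \<open>j r\<close> coloured \<open>r\<close> for every \<open>r\<close> under a fraction \<open>k^-k\<close> of all colourings, so it
  suffices to treat tuples whose \<open>r\<close>-th entry comes from an \<open>r\<close>-th block, with disjoint blocks.
  Integrating out one block at a time: given the other blocks, a maximum over one block of \<open>c i * Y i\<close>
  is a Frechet variable of scale \<open>s = \<Sum> c i * m i\<close>, hence at least of order \<open>s\<close> with
  large probability. Several such maxima may be strongly dependent, but by Markov's inequality their
  sum is, with probability at least one half, at least a quarter of the sum of their scales
  (\<open>emeasure_sum_max_ge\<close>). Each block thus turns one maximum into a sum, at the cost of a factor 4
  in the level and a factor 2 in the probability.
\<close>

section \<open>Powers of extended nonnegative reals\<close>

lemma ennpowr_ennreal: "0 \<le> r \<Longrightarrow> ennpowr (ennreal r) a = ennreal (r powr a)"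
  by (simp add: ennpowr_def)

lemma ennpowr_top: "ennpowr \<top> a = \<top>"
  by (simp add: ennpowr_def)

lemma ennpowr_0: "ennpowr 0 a = 0"
  by (simp add: ennpowr_def)

lemma ennpowr_less_iff:
  assumes "0 < a" shows "ennpowr x a < ennpowr y a \<longleftrightarrow> x < y"
proof -
  have *: "r powr a < s powr a \<longleftrightarrow> r < s" if "0 \<le> r" "0 \<le> s" for r s :: real
    using assms that powr_less_mono2[of a r s] powr_mono2[of a s r] by (auto simp flip: not_le)
  show ?thesis
    by (cases x; cases y) (auto simp: ennpowr_ennreal ennpowr_top ennreal_less_iff * top.not_eq_extremum)
qed

lemma ennpowr_le_iff:
  assumes "0 < a" shows "ennpowr x a \<le> ennpowr y a \<longleftrightarrow> x \<le> y"
  using ennpowr_less_iff[OF assms, of y x] by (simp flip: not_less)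

lemma ennpowr_mult:
  assumes "0 < a" shows "ennpowr (x * y) a = ennpowr x a * ennpowr y a"
proof (cases "x = 0 \<or> y = 0")
  case True then show ?thesis by (auto simp: ennpowr_0)
next
  case False
  then show ?thesis
    by (cases x; cases y) (auto simp: ennpowr_top ennpowr_ennreal powr_mult ennreal_mult_top
        ennreal_top_mult simp flip: ennreal_mult)
qed

lemma ennpowr_prod:
  assumes "0 < a" shows "ennpowr (\<Prod>i\<in>A. x i) a = (\<Prod>i\<in>A. ennpowr (x i) a)"
  by (induction A rule: infinite_finite_induct)
    (auto simp: ennpowr_mult[OF assms] ennpowr_ennreal[of 1, simplified])

lemma ennpowr_measurable [measurable]: "(\<lambda>x. ennpowr x a) \<in> borel_measurable borel"
  unfolding ennpowr_def by measurable

lemma ennpowr_inverse: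
  assumes "0 < a" shows "ennpowr (ennpowr x (1 / a)) a = x"
  using assms by (cases x) (auto simp: ennpowr_ennreal ennpowr_top powr_powr)

text \<open>Lower semicontinuity of the power is all that Fatou's lemma requires of it.\<close>
lemma ennpowr_le_liminf:
  assumes a: "0 < a" and lim: "X \<longlonglongrightarrow> x"
  shows "ennpowr x a \<le> liminf (\<lambda>n. ennpowr (X n) a)"
proof (rule le_Liminf_iff[THEN iffD2], intro allI impI)
  fix y assume "y < ennpowr x a"
  then have "ennpowr y (1 / a) < x"
    using ennpowr_less_iff[OF a, of "ennpowr y (1 / a)" x] by (simp add: ennpowr_inverse[OF a])
  then have "eventually (\<lambda>n. ennpowr y (1 / a) < X n) sequentially"
    using lim by (simp add: order_tendstoD(1))
  then show "eventually (\<lambda>n. y < ennpowr (X n) a) sequentially"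
    by eventually_elim
      (use ennpowr_less_iff[OF a, of "ennpowr y (1 / a)"] in \<open>simp add: ennpowr_inverse[OF a]\<close>)
qed

section \<open>Maxima of monomials in independent Frechet variables\<close>

text \<open>
  Laws that stochastically dominate the Frechet law with exponent 1 and scale \<open>m i\<close>. The
  \<open>\<alpha>\<close>-th power of an \<open>\<alpha>\<close>-Frechet variable has this law with equality, so the exponent
  disappears from the combinatorial part. The coordinates are real, and products of them are taken
  in \<^typ>\<open>ennreal\<close> after truncation at 0, which keeps every monomial finite and nonnegative.
\<close>
locale frechet_laws = product_prob_space N UNIV
  for N :: "nat \<Rightarrow> real measure" +
  fixes m :: "nat \<Rightarrow> real"
  assumes sets_N [measurable_cong]: "\<And>i. sets (N i) = sets borel"
    and scale_nonneg: "\<And>i. 0 \<le> m i"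
    and cdf_le: "\<And>i y. 0 < y \<Longrightarrow> emeasure (N i) {..y} \<le> ennreal (exp (- (m i / y)))"
begin

lemma space_N: "space (N i) = UNIV"
  using sets_eq_imp_space_eq[OF sets_N] by simp

text \<open>
  By independence the left-hand side is at most \<open>\<Prod> exp (- 2 * c i * m i / s) = exp (-2)\<close>: a weighted
  maximum of independent Frechet variables is again Frechet, and \<open>s\<close> is its scale. Comparing with \<open>s / 2\<close> rather than
  \<open>s\<close> makes this probability at most a quarter.
\<close>
lemma emeasure_weighted_max_le:
  fixes c :: "nat \<Rightarrow> real"
  assumes I: "finite I" and c: "\<And>i. 0 \<le> c i" and s: "s = (\<Sum>i\<in>I. c i * m i)" "0 < s"
  shows "emeasure (PiM I N) {y \<in> space (PiM I N). (SUP i\<in>I. ennreal (c i) * ennreal (y i)) \<le> ennreal (s / 2)}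
    \<le> ennreal (1 / 4)"
proof -
  let ?A = "\<lambda>i. if c i = 0 then UNIV else {..s / (2 * c i)}"
  have "emeasure (PiM I N) {y \<in> space (PiM I N). (SUP i\<in>I. ennreal (c i) * ennreal (y i)) \<le> ennreal (s / 2)}
      \<le> emeasure (PiM I N) (PiE I ?A)"
  proof (rule emeasure_mono)
    show "{y \<in> space (PiM I N). (SUP i\<in>I. ennreal (c i) * ennreal (y i)) \<le> ennreal (s / 2)} \<subseteq> PiE I ?A"
    proof (rule subsetI)
      fix y assume "y \<in> {y \<in> space (PiM I N). (SUP i\<in>I. ennreal (c i) * ennreal (y i)) \<le> ennreal (s / 2)}"
      then have y: "y \<in> space (PiM I N)" and le: "(SUP i\<in>I. ennreal (c i) * ennreal (y i)) \<le> ennreal (s / 2)"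
        by auto
      have "y i \<le> s / (2 * c i)" if i: "i \<in> I" "c i \<noteq> 0" for i
      proof -
        have "0 < c i" using i c[of i] by simp
        have "ennreal (c i) * ennreal (y i) \<le> ennreal (s / 2)"
          using le i(1) by (simp add: SUP_le_iff)
        then have "c i * y i \<le> s / 2"
          using c[of i] s(2) by (simp add: ennreal_mult'[symmetric])
        then show ?thesis
          using \<open>0 < c i\<close> by (simp add: field_simps)
      qed
      then show "y \<in> PiE I ?A"
        using y by (auto simp: space_PiM PiE_iff)
    qed
    show "PiE I ?A \<in> sets (PiM I N)"
      using I by (intro sets_PiM_I_finite) (auto simp: sets_N)
  qed
  also have "\<dots> = (\<Prod>i\<in>I. emeasure (N i) (?A i))"
    using I by (intro emeasure_PiM) (auto simp: sets_N)
  also have "\<dots> \<le> (\<Prod>i\<in>I. ennreal (exp (- (2 * (c i * m i) / s))))"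
  proof (rule prod_mono_ennreal)
    fix i assume "i \<in> I"
    show "emeasure (N i) (?A i) \<le> ennreal (exp (- (2 * (c i * m i) / s)))"
    proof (cases "c i = 0")
      case True
      then show ?thesis using M.emeasure_space_1[of i] by (simp add: space_N)
    next
      case False
      then have "0 < c i" using c[of i] by simp
      then show ?thesis using cdf_le[of "s / (2 * c i)" i] s(2) by (simp add: mult_ac)
    qed
  qed
  also have "\<dots> = ennreal (exp (\<Sum>i\<in>I. - (2 * (c i * m i) / s)))"
    using I by (simp add: prod_ennreal exp_sum)
  also have "(\<Sum>i\<in>I. - (2 * (c i * m i) / s)) = -2"
    using s by (simp add: sum_negf flip: sum_divide_distrib sum_distrib_left)
  also have "exp (-2 :: real) \<le> 1 / 4"
  proof -
    \<comment> \<open>The crude estimate \<open>e \<ge> 2\<close> is enough.\<close>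
    have "(2::real) ^ 2 \<le> exp 1 ^ 2"
      using exp_ge_add_one_self[of "1::real"] by (intro power_mono) auto
    then have "4 \<le> exp (2::real)" by (simp flip: exp_of_nat_mult)
    then show ?thesis by (simp add: exp_minus field_simps)
  qed
  finally show ?thesis by (simp add: ennreal_leI)
qed

text \<open>
  The summands for different \<open>J\<close> share the same variables, so nothing can be multiplied. Instead
  call \<open>J\<close> bad when its maximum is at most half of its scale \<open>s J\<close>. The expected total scale of the
  bad \<open>J\<close> is at most a quarter of the total scale \<open>S\<close>, so by Markov's inequality it is below
  \<open>S / 2\<close> with probability at least one half, and then the other \<open>J\<close> alone contribute more
  than \<open>S / 4\<close>.
\<close>
lemma emeasure_sum_max_ge:
  fixes c :: "'t \<Rightarrow> nat \<Rightarrow> ennreal"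
  assumes I: "finite I" and T: "finite T" and c: "\<And>J i. J \<in> T \<Longrightarrow> i \<in> I \<Longrightarrow> c J i < \<top>"
    and L: "4 * L < (\<Sum>J\<in>T. \<Sum>i\<in>I. c J i * ennreal (m i))"
  shows "ennreal (1 / 2) \<le> emeasure (PiM I N)
    {y \<in> space (PiM I N). L < (\<Sum>J\<in>T. SUP i\<in>I. c J i * ennreal (y i))}"
proof -
  interpret Q: prob_space "PiM I N" by (rule prob_space_PiM) (rule M.prob_space_axioms)
  define s where "s J = (\<Sum>i\<in>I. c J i * ennreal (m i))" for J
  define S where "S = (\<Sum>J\<in>T. s J)"
  define Z where "Z J y = (SUP i\<in>I. c J i * ennreal (y i))" for J and y :: "nat \<Rightarrow> real"
  define D where "D y = (\<Sum>J\<in>T. s J * indicator {y \<in> space (PiM I N). Z J y \<le> s J / 2} y)" for y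
  have Z_meas [measurable]: "Z J \<in> borel_measurable (PiM I N)" for J
    unfolding Z_def using I by (intro borel_measurable_SUP countable_finite) measurable
  have D_meas [measurable]: "D \<in> borel_measurable (PiM I N)"
    unfolding D_def by measurable
  have s_fin: "s J < \<top>" if "J \<in> T" for J
    using c[OF that] I by (simp add: s_def ennreal_mult_less_top)
  have S_fin: "S < \<top>" using s_fin T by (simp add: S_def)
  have S_pos: "0 < S" using L by (auto simp: S_def s_def intro: le_less_trans[OF _ L])
  have bad: "s J * emeasure (PiM I N) {y \<in> space (PiM I N). Z J y \<le> s J / 2} \<le> s J * ennreal (1 / 4)" if J: "J \<in> T" for J
  proof (cases "s J = 0")
    case False
    \<comment> \<open>The weights are finite on \<open>I\<close>; the value 0 elsewhere makes \<open>r\<close> nonnegative everywhere.\<close>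
    define r where "r i = enn2real (if i \<in> I then c J i else 0)" for i
    have cr: "c J i = ennreal (r i)" if "i \<in> I" for i
      using c[OF J that] that by (simp add: r_def)
    have sr: "s J = ennreal (\<Sum>i\<in>I. r i * m i)"
    proof -
      have "s J = (\<Sum>i\<in>I. ennreal (r i * m i))"
        unfolding s_def by (intro sum.cong refl) (simp add: cr ennreal_mult'' scale_nonneg)
      also have "\<dots> = ennreal (\<Sum>i\<in>I. r i * m i)"
        by (intro sum_ennreal) (simp add: r_def scale_nonneg)
      finally show ?thesis .
    qed
    have pos: "0 < (\<Sum>i\<in>I. r i * m i)"
      using False by (simp add: sr ennreal_eq_0_iff not_le)
    have half: "s J / 2 = ennreal ((\<Sum>i\<in>I. r i * m i) / 2)"
      using pos by (simp add: sr ennreal_divide_numeral)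
    have "emeasure (PiM I N) {y \<in> space (PiM I N). Z J y \<le> s J / 2} \<le> ennreal (1 / 4)"
    proof -
      have r: "0 \<le> r i" for i
        by (simp add: r_def)
      have "Z J y = (SUP i\<in>I. ennreal (r i) * ennreal (y i))" for y
        unfolding Z_def by (intro SUP_cong refl) (simp only: cr)
      then show ?thesis
        using emeasure_weighted_max_le[OF I r refl pos] by (simp only: half)
    qed
    then show ?thesis by (intro mult_left_mono) auto
  qed simp
  have intD: "(\<integral>\<^sup>+y. D y \<partial>PiM I N) \<le> S * ennreal (1 / 4)"
    unfolding D_def S_def sum_distrib_right
    by (subst nn_integral_sum) (auto simp: nn_integral_cmult_indicator intro!: sum_mono bad)
  have "emeasure (PiM I N) {y \<in> space (PiM I N). \<not> L < (\<Sum>J\<in>T. Z J y)}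
      \<le> emeasure (PiM I N) {y \<in> space (PiM I N). 1 \<le> (2 / S) * D y}"
  proof (intro emeasure_mono subsetI)
    fix y assume y: "y \<in> {y \<in> space (PiM I N). \<not> L < (\<Sum>J\<in>T. Z J y)}"
    have "s J \<le> 2 * Z J y + s J * indicator {y \<in> space (PiM I N). Z J y \<le> s J / 2} y" for J
    proof (cases "Z J y \<le> s J / 2")
      case False
      then have "2 * (s J / 2) \<le> 2 * Z J y" by (intro mult_left_mono) auto
      then show ?thesis using False by (simp add: ennreal_times_divide ennreal_mult_divide_eq mult.commute)
    qed (use y in simp)
    then have "S \<le> (\<Sum>J\<in>T. 2 * Z J y + s J * indicator {y \<in> space (PiM I N). Z J y \<le> s J / 2} y)"
      unfolding S_def by (rule sum_mono)
    also have "\<dots> = 2 * (\<Sum>J\<in>T. Z J y) + D y"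
      by (simp add: sum.distrib D_def sum_distrib_left)
    also have "\<dots> \<le> 2 * L + D y"
      using y by (intro add_right_mono mult_left_mono) auto
    finally have 1: "S \<le> 2 * L + D y" .
    have 2: "4 * L < S" using L by (simp add: S_def s_def)
    have "S \<le> 2 * D y"
    proof (cases "D y = \<top>")
      case False
      with 1 2 S_fin show ?thesis
        by (cases S; cases "D y"; cases L)
          (auto simp: ennreal_mult_top ennreal_mult_eq_top_iff top_unique simp flip: ennreal_numeral ennreal_mult ennreal_plus
            simp: ennreal_less_iff)
    qed (simp add: ennreal_mult_top)
    then have "1 \<le> (2 * D y) / S"
      using S_pos S_fin by (metis divide_right_mono_ennreal ennreal_divide_self less_irrefl)
    then show "y \<in> {y \<in> space (PiM I N). 1 \<le> (2 / S) * D y}"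
      using y by (simp add: ennreal_times_divide mult.commute)
  qed measurable
  also have "\<dots> \<le> (2 / S) * (\<integral>\<^sup>+y. D y * indicator (space (PiM I N)) y \<partial>PiM I N)"
    by (rule nn_integral_Markov_inequality) simp_all
  also have "\<dots> = (2 / S) * (\<integral>\<^sup>+y. D y \<partial>PiM I N)"
    by (intro arg_cong[where f = "\<lambda>x. (2 / S) * x"] nn_integral_cong) auto
  also have "\<dots> \<le> (2 / S) * (S * ennreal (1 / 4))"
    by (intro mult_left_mono intD) auto
  also have "\<dots> = ennreal (1 / 2)"
    using S_pos S_fin by (cases S) (auto simp: divide_ennreal ennreal_less_iff simp flip: ennreal_numeral ennreal_mult)
  finally have "Q.prob {y \<in> space (PiM I N). \<not> L < (\<Sum>J\<in>T. Z J y)} \<le> 1 / 2"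
    unfolding Q.emeasure_eq_measure by (subst (asm) ennreal_le_iff) simp_all
  moreover have "Q.prob {y \<in> space (PiM I N). \<not> L < (\<Sum>J\<in>T. Z J y)} = 1 - Q.prob {y \<in> space (PiM I N). L < (\<Sum>J\<in>T. Z J y)}"
    by (rule Q.prob_neg) measurable
  ultimately show ?thesis
    unfolding Q.emeasure_eq_measure Z_def by (intro ennreal_leI) linarith
qed

end

lemma finite_SUP_less_top:
  fixes g :: "'a \<Rightarrow> ennreal"
  assumes "finite A" "\<And>a. a \<in> A \<Longrightarrow> g a < \<top>"
  shows "(SUP a\<in>A. g a) < \<top>"
  using assms by (induction A rule: finite_induct) (auto simp: bot_ennreal sup_max)

lemma prod_ennreal_less_top: "(\<Prod>r<(k::nat). ennreal (f r)) < \<top>"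
  by (induction k) (auto simp: ennreal_mult_less_top)

lemma prod_fun_upd_lessThan_Suc:
  fixes h :: "'a \<Rightarrow> 'b :: comm_monoid_mult"
  shows "(\<Prod>r<Suc k. h ((j(k := i)) r)) = (\<Prod>r<k. h (j r)) * h i"
  by simp

lemma PiE_lessThan_Suc:
  "PiE {..<Suc k} I = (\<lambda>(i, j). j(k := i)) ` (I k \<times> PiE {..<k} I)"
  by (simp add: lessThan_Suc PiE_insert_eq)

lemma sum_PiE_lessThan_Suc:
  fixes g :: "(nat \<Rightarrow> 'a) \<Rightarrow> 'b :: comm_monoid_add"
  shows "(\<Sum>j\<in>PiE {..<Suc k} I. g j) = (\<Sum>i\<in>I k. \<Sum>j\<in>PiE {..<k} I. g (j(k := i)))"
proof -
  have "inj_on (\<lambda>(i, j). j(k := i)) (I k \<times> PiE {..<k} I)"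
    by (rule inj_combinator) simp
  then show ?thesis
    unfolding PiE_lessThan_Suc
    by (subst sum.reindex) (simp_all add: sum.cartesian_product case_prod_unfold)
qed

lemma SUP_PiE_lessThan_Suc:
  fixes g :: "(nat \<Rightarrow> 'a) \<Rightarrow> ennreal"
  shows "(SUP j\<in>PiE {..<Suc k} I. g j) = (SUP i\<in>I k. SUP j\<in>PiE {..<k} I. g (j(k := i)))"
proof -
  have "(SUP j\<in>PiE {..<Suc k} I. g j) = (SUP x\<in>I k \<times> PiE {..<k} I. g ((snd x)(k := fst x)))"
    unfolding PiE_lessThan_Suc by (simp add: image_image case_prod_unfold)
  also have "\<dots> = (SUP i\<in>I k. SUP j\<in>PiE {..<k} I. g (j(k := i)))"
  proof (rule antisym)
    show "(SUP x\<in>I k \<times> PiE {..<k} I. g ((snd x)(k := fst x)))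
        \<le> (SUP i\<in>I k. SUP j\<in>PiE {..<k} I. g (j(k := i)))"
    proof (rule SUP_least)
      fix x assume "x \<in> I k \<times> PiE {..<k} I"
      then have x: "fst x \<in> I k" "snd x \<in> PiE {..<k} I"
        by (simp_all add: mem_Times_iff)
      have "g ((snd x)(k := fst x)) \<le> (SUP j\<in>PiE {..<k} I. g (j(k := fst x)))"
        using SUP_upper[OF x(2), of "\<lambda>j. g (j(k := fst x))"] by simp
      also have "\<dots> \<le> (SUP i\<in>I k. SUP j\<in>PiE {..<k} I. g (j(k := i)))"
        using SUP_upper[OF x(1), of "\<lambda>i. SUP j\<in>PiE {..<k} I. g (j(k := i))"] by simp
      finally show "g ((snd x)(k := fst x)) \<le> (SUP i\<in>I k. SUP j\<in>PiE {..<k} I. g (j(k := i)))" .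
    qed
    show "(SUP i\<in>I k. SUP j\<in>PiE {..<k} I. g (j(k := i)))
        \<le> (SUP x\<in>I k \<times> PiE {..<k} I. g ((snd x)(k := fst x)))"
    proof (intro SUP_least)
      fix i j assume "i \<in> I k" "j \<in> PiE {..<k} I"
      then have "(i, j) \<in> I k \<times> PiE {..<k} I" by simp
      from SUP_upper[OF this, of "\<lambda>x. g ((snd x)(k := fst x))"]
      show "g (j(k := i)) \<le> (SUP x\<in>I k \<times> PiE {..<k} I. g ((snd x)(k := fst x)))"
        by simp
    qed
  qed
  finally show ?thesis .
qed

context frechet_laws
begin

lemma max_monomial_measurable:
  assumes "finite A" "\<And>j r. j \<in> A \<Longrightarrow> r < k \<Longrightarrow> j r \<in> U"
  shows "(\<lambda>y. SUP j\<in>A. v j * (\<Prod>r<k. ennreal (y (j r)))) \<in> borel_measurable (PiM U N)"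
proof (rule borel_measurable_SUP)
  show "countable A" using assms(1) by (rule countable_finite)
  fix j assume j: "j \<in> A"
  have [measurable]: "(\<lambda>y. y (j r)) \<in> borel_measurable (PiM U N)" if "r < k" for r
    using measurable_component_singleton[of "j r" U N] assms(2)[OF j that]
    by (simp add: measurable_cong_sets[OF refl sets_N])
  have "(\<lambda>y. \<Prod>r<k. ennreal (y (j r))) \<in> borel_measurable (PiM U N)"
    by (rule borel_measurable_prod_ennreal) measurable
  then show "(\<lambda>y. v j * (\<Prod>r<k. ennreal (y (j r)))) \<in> borel_measurable (PiM U N)"
    by measurable
qed

text \<open>
  Induction on the number of blocks. The outer sum over \<open>T\<close> is there for the induction: integrating
  out the block \<open>I k\<close> replaces the maximum over it by a sum, which joins the outer sum. The list \<open>J\<close>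
  records the indices summed so far, so that the type of the outer index stays the same.
\<close>
lemma emeasure_sum_max_disjoint_blocks_ge:
  fixes v :: "nat list \<Rightarrow> (nat \<Rightarrow> nat) \<Rightarrow> ennreal" and I :: "nat \<Rightarrow> nat set"
  assumes "\<And>r. r < k \<Longrightarrow> finite (I r)" "disjoint_family_on I {..<k}" "finite T"
    and "\<And>J j. v J j < \<top>"
    and "4 ^ k * L < (\<Sum>J\<in>T. \<Sum>j\<in>PiE {..<k} I. v J j * (\<Prod>r<k. ennreal (m (j r))))"
  shows "ennreal (1 / 2) ^ k \<le> emeasure (PiM (\<Union>r<k. I r) N)
    {y \<in> space (PiM (\<Union>r<k. I r) N).
      L < (\<Sum>J\<in>T. SUP j\<in>PiE {..<k} I. v J j * (\<Prod>r<k. ennreal (y (j r))))}"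
  using assms
proof (induction k arbitrary: T v L)
  case 0
  then have "{y \<in> space (PiM {} N). L < (\<Sum>J\<in>T. v J (\<lambda>_. undefined))} = space (PiM {} N)"
    by simp
  then show ?case
    using prob_space.emeasure_space_1[OF prob_space_PiM, of "{}" N] M.prob_space_axioms by simp
next
  case (Suc k)
  define U where "U = (\<Union>r<k. I r)"
  define V where "V = I k"
  have fin: "finite U" "finite V" "\<And>r. r < k \<Longrightarrow> finite (I r)"
    using Suc.prems(1) by (auto simp: U_def V_def)
  have UV: "(\<Union>r<Suc k. I r) = U \<union> V"
    by (auto simp: U_def V_def lessThan_Suc)
  have disj': "disjoint_family_on I {..<k}"
    by (rule disjoint_family_on_mono[OF _ Suc.prems(2)]) auto
  have "I r \<inter> I k = {}" if "r < k" for r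
    using that by (intro disjoint_family_onD[OF Suc.prems(2)]) auto
  then have disj: "U \<inter> V = {}"
    by (auto simp: U_def V_def)
  have finPi: "finite (PiE {..<k} I)"
    using fin by (intro finite_PiE) auto
  \<comment> \<open>\<open>Q x J i\<close> is the weight of the \<open>i\<close>-th variable of the last block, given the values \<open>x\<close> of
    the other blocks. \<open>A\<close> is the event to which the induction hypothesis applies.\<close>
  define Q where "Q x J i = (SUP j\<in>PiE {..<k} I. v J (j(k := i)) * (\<Prod>r<k. ennreal (x (j r))))"
    for x :: "nat \<Rightarrow> real" and J i
  define T' where "T' = (\<lambda>(i, J). i # J) ` (V \<times> T)"
  define v' where "v' J j = v (tl J) (j(k := hd J)) * ennreal (m (hd J))" for J j
  define A where "A = {x \<in> space (PiM U N). 4 * L < (\<Sum>J\<in>T. \<Sum>i\<in>V. Q x J i * ennreal (m i))}"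
  define B where "B = {y \<in> space (PiM (U \<union> V) N).
      L < (\<Sum>J\<in>T. SUP j\<in>PiE {..<Suc k} I. v J j * (\<Prod>r<Suc k. ennreal (y (j r))))}"
  have sumT': "(\<Sum>J\<in>T'. G J) = (\<Sum>J\<in>T. \<Sum>i\<in>V. G (i # J))" for G :: "nat list \<Rightarrow> ennreal"
  proof -
    have "(\<Sum>J\<in>T'. G J) = (\<Sum>(i, J)\<in>V \<times> T. G (i # J))"
      unfolding T'_def by (subst sum.reindex) (auto simp: inj_on_def case_prod_unfold)
    also have "\<dots> = (\<Sum>i\<in>V. \<Sum>J\<in>T. G (i # J))"
      by (rule sum.cartesian_product[symmetric])
    also have "\<dots> = (\<Sum>J\<in>T. \<Sum>i\<in>V. G (i # J))"
      by (rule sum.swap)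
    finally show ?thesis .
  qed
  have "4 ^ k * (4 * L) < (\<Sum>J\<in>T'. \<Sum>j\<in>PiE {..<k} I. v' J j * (\<Prod>r<k. ennreal (m (j r))))"
    using Suc.prems(5)
    unfolding sumT' sum_PiE_lessThan_Suc prod_fun_upd_lessThan_Suc v'_def V_def
    by (simp add: mult_ac)
  then have "ennreal (1 / 2) ^ k \<le> emeasure (PiM U N) {x \<in> space (PiM U N). 4 * L <
      (\<Sum>J\<in>T'. SUP j\<in>PiE {..<k} I. v' J j * (\<Prod>r<k. ennreal (x (j r))))}"
    unfolding U_def using Suc.prems(3,4) fin disj'
    by (intro Suc.IH) (auto simp: T'_def v'_def ennreal_mult_less_top)
  also have "(\<lambda>x. \<Sum>J\<in>T'. SUP j\<in>PiE {..<k} I. v' J j * (\<Prod>r<k. ennreal (x (j r)))) =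
      (\<lambda>x. \<Sum>J\<in>T. \<Sum>i\<in>V. Q x J i * ennreal (m i))"
    unfolding sumT' Q_def SUP_mult_right_ennreal v'_def list.sel
    by (intro ext sum.cong SUP_cong refl) (simp add: mult_ac)
  finally have IH: "ennreal (1 / 2) ^ k \<le> emeasure (PiM U N) A"
    unfolding A_def by metis
  have Q_meas [measurable]: "(\<lambda>x. Q x J i) \<in> borel_measurable (PiM U N)" for J i
    unfolding Q_def by (rule max_monomial_measurable) (use finPi in \<open>auto simp: U_def PiE_iff\<close>)
  have A_meas [measurable]: "A \<in> sets (PiM U N)"
    unfolding A_def by measurable
  have [measurable]: "(\<lambda>y. SUP j\<in>PiE {..<Suc k} I. v J j * (\<Prod>r<Suc k. ennreal (y (j r))))
      \<in> borel_measurable (PiM (U \<union> V) N)" for J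
    by (rule max_monomial_measurable)
      (use Suc.prems(1) UV in \<open>auto intro!: finite_PiE simp: PiE_iff\<close>)
  have B_meas [measurable]: "B \<in> sets (PiM (U \<union> V) N)"
    unfolding B_def by measurable
  have B_merge: "merge U V (x, y) \<in> B \<longleftrightarrow> L < (\<Sum>J\<in>T. SUP i\<in>V. Q x J i * ennreal (y i))"
    if x: "x \<in> space (PiM U N)" and y: "y \<in> space (PiM V N)" for x y
  proof -
    have "(SUP j\<in>PiE {..<Suc k} I. v J j * (\<Prod>r<Suc k. ennreal (merge U V (x, y) (j r)))) =
        (SUP i\<in>V. Q x J i * ennreal (y i))" for J
    proof -
      have "v J (j(k := i)) * (\<Prod>r<Suc k. ennreal (merge U V (x, y) ((j(k := i)) r))) =
          (v J (j(k := i)) * (\<Prod>r<k. ennreal (x (j r)))) * ennreal (y i)"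
        if "i \<in> V" "j \<in> PiE {..<k} I" for i j
      proof -
        have "(\<Prod>r<k. ennreal (merge U V (x, y) (j r))) = (\<Prod>r<k. ennreal (x (j r)))"
          using that disj by (intro prod.cong refl arg_cong[where f = ennreal] merge_apply) (auto simp: U_def PiE_iff)
        then show ?thesis
          using that disj unfolding prod_fun_upd_lessThan_Suc by (simp add: mult_ac)
      qed
      then show ?thesis
        unfolding SUP_PiE_lessThan_Suc Q_def SUP_mult_right_ennreal V_def[symmetric]
        by (intro SUP_cong refl) auto
    qed
    moreover have "merge U V (x, y) \<in> space (PiM (U \<union> V) N)"
      using x y disj by (simp add: space_PiM PiE_def)
    ultimately show ?thesis
      by (simp add: B_def)
  qed
  have inner: "ennreal (1 / 2) * indicator A x \<le> (\<integral>\<^sup>+y. indicator B (merge U V (x, y)) \<partial>PiM V N)"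
    if x: "x \<in> space (PiM U N)" for x
  proof (cases "x \<in> A")
    case True
    have "ennreal (1 / 2) \<le> emeasure (PiM V N) {y \<in> space (PiM V N). L < (\<Sum>J\<in>T. SUP i\<in>V. Q x J i * ennreal (y i))}"
    proof (rule emeasure_sum_max_ge)
      show "Q x J i < \<top>" for J i
        unfolding Q_def using finPi Suc.prems(4)
        by (intro finite_SUP_less_top) (simp_all add: ennreal_mult_less_top prod_ennreal_less_top)
    qed (use True fin Suc.prems(3) in \<open>auto simp: A_def\<close>)
    also have "\<dots> = (\<integral>\<^sup>+y. indicator {y \<in> space (PiM V N). L < (\<Sum>J\<in>T. SUP i\<in>V. Q x J i * ennreal (y i))} y \<partial>PiM V N)"
      using fin(2) by (intro nn_integral_indicator[symmetric]) measurable
    also have "\<dots> = (\<integral>\<^sup>+y. indicator B (merge U V (x, y)) \<partial>PiM V N)"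
      by (intro nn_integral_cong) (simp add: indicator_def B_merge[OF x])
    finally show ?thesis using True by simp
  qed simp
  have "ennreal (1 / 2) ^ Suc k \<le> ennreal (1 / 2) * emeasure (PiM U N) A"
    using mult_left_mono[OF IH, of "ennreal (1 / 2)"] by simp
  also have "\<dots> = (\<integral>\<^sup>+x. ennreal (1 / 2) * indicator A x \<partial>PiM U N)"
    by (simp add: nn_integral_cmult_indicator)
  also have "\<dots> \<le> (\<integral>\<^sup>+x. \<integral>\<^sup>+y. indicator B (merge U V (x, y)) \<partial>PiM V N \<partial>PiM U N)"
    by (intro nn_integral_mono inner)
  also have "\<dots> = (\<integral>\<^sup>+y. indicator B y \<partial>PiM (U \<union> V) N)"
    using fin disj by (intro product_nn_integral_fold[symmetric]) auto
  also have "\<dots> = emeasure (PiM (U \<union> V) N) B"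
    by simp
  finally show ?case
    unfolding UV B_def .
qed

end

text \<open>
  A colouring of \<open>p\<close> indices is prescribed at the \<open>k\<close> distinct entries of \<open>j\<close> and free elsewhere.
  The product form avoids the exponent \<open>p - k\<close>.
\<close>
lemma card_colourings:
  assumes inj: "inj_on j {..<k}" and j: "j \<in> {..<k} \<rightarrow> {..<p}"
  shows "card {c \<in> PiE {..<p} (\<lambda>_. {..<k}). \<forall>r<k. c (j r) = r} * k ^ k = k ^ p"
proof -
  let ?K = "\<lambda>i. if i \<in> j ` {..<k} then {the_inv_into {..<k} j i} else {..<k}"
  have "{c \<in> PiE {..<p} (\<lambda>_. {..<k}). \<forall>r<k. c (j r) = r} = PiE {..<p} ?K"
  proof (intro set_eqI iffI)
    fix c assume "c \<in> {c \<in> PiE {..<p} (\<lambda>_. {..<k}). \<forall>r<k. c (j r) = r}"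
    then show "c \<in> PiE {..<p} ?K"
      using inj by (auto simp: PiE_iff the_inv_into_f_f)
  next
    fix c assume c: "c \<in> PiE {..<p} ?K"
    have "c (j r) = r" if "r < k" for r
      using PiE_mem[OF c, of "j r"] that j inj by (auto simp: the_inv_into_f_f)
    moreover have "c i < k" if "i < p" for i
      using PiE_mem[OF c, of i] that inj by (auto simp: the_inv_into_f_f split: if_splits)
    ultimately show "c \<in> {c \<in> PiE {..<p} (\<lambda>_. {..<k}). \<forall>r<k. c (j r) = r}"
      using c by (auto simp: PiE_iff)
  qed
  then have "card {c \<in> PiE {..<p} (\<lambda>_. {..<k}). \<forall>r<k. c (j r) = r}
      = (\<Prod>i<p. if i \<in> j ` {..<k} then 1 else k)"
    by (simp add: card_PiE if_distrib[of card] cong: if_cong)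
  moreover have "k ^ k = (\<Prod>i<p. if i \<in> j ` {..<k} then k else 1)"
  proof -
    have "{..<p} \<inter> {i. i \<in> j ` {..<k}} = j ` {..<k}"
      using j by auto
    then show ?thesis
      using inj by (simp add: prod.If_cases card_image)
  qed
  ultimately have "card {c \<in> PiE {..<p} (\<lambda>_. {..<k}). \<forall>r<k. c (j r) = r} * k ^ k =
      (\<Prod>i<p. (if i \<in> j ` {..<k} then 1 else k) * (if i \<in> j ` {..<k} then k else 1))"
    by (simp only: prod.distrib)
  also have "\<dots> = (\<Prod>i<p. k)"
    by (intro prod.cong) auto
  finally show ?thesis by simp
qed

text \<open>
  Every colouring \<open>c\<close> of the indices defines disjoint blocks, on which the previous estimate bounds
  the part of the sum compatible with \<open>c\<close> by \<open>4^k L\<close>. Summing over all \<open>k^p\<close> colourings counts each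
  injective tuple \<open>k^p / k^k\<close> times. Tuples with a repeated entry are compatible with no colouring,
  hence the hypothesis that \<open>v\<close> vanishes on them; it reflects that the integrand vanishes on the
  diagonal.
\<close>
lemma (in frechet_laws) sum_le_of_prob_max_less:
  fixes v :: "(nat \<Rightarrow> nat) \<Rightarrow> ennreal"
  assumes k: "1 \<le> k" and v: "\<And>j. v j < \<top>"
    and v0: "\<And>j. j \<in> PiE {..<k} (\<lambda>_. {..<p}) \<Longrightarrow> \<not> inj_on j {..<k} \<Longrightarrow> v j = 0"
    and prob: "emeasure (PiM {..<p} N) {y \<in> space (PiM {..<p} N).
      L < (SUP j\<in>PiE {..<k} (\<lambda>_. {..<p}). v j * (\<Prod>r<k. ennreal (y (j r))))} < ennreal (1 / 2) ^ k"
  shows "(\<Sum>j\<in>PiE {..<k} (\<lambda>_. {..<p}). v j * (\<Prod>r<k. ennreal (m (j r)))) \<le> (4 * of_nat k) ^ k * L"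
proof -
  define C where "C = PiE {..<p} (\<lambda>_. {..<k})"
  define W where "W = PiE {..<k} (\<lambda>_. {..<p})"
  define I where "I c r = {i. i < p \<and> c i = r}" for c :: "nat \<Rightarrow> nat" and r
  define g where "g j = v j * (\<Prod>r<k. ennreal (m (j r)))" for j
  have finC: "finite C" and finW: "finite W"
    unfolding C_def W_def by (auto intro!: finite_PiE)
  have Ifin: "finite (I c r)" and Idisj: "disjoint_family_on (I c) X" for c r X
    by (auto simp: I_def disjoint_family_on_def)
  have IW: "PiE {..<k} (I c) = {j \<in> W. \<forall>r<k. c (j r) = r}" for c
    unfolding I_def W_def set_eq_iff PiE_iff mem_Collect_eq Ball_def lessThan_iff by blast
  have coloured: "(\<Sum>j\<in>PiE {..<k} (I c). g j) \<le> 4 ^ k * L" if c: "c \<in> C" for c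
  proof (rule ccontr)
    assume "\<not> (\<Sum>j\<in>PiE {..<k} (I c). g j) \<le> 4 ^ k * L"
    then have "4 ^ k * L < (\<Sum>J\<in>{[]::nat list}. \<Sum>j\<in>PiE {..<k} (I c). v j * (\<Prod>r<k. ennreal (m (j r))))"
      by (simp add: g_def)
    then have "ennreal (1 / 2) ^ k \<le> emeasure (PiM (\<Union>r<k. I c r) N)
      {y \<in> space (PiM (\<Union>r<k. I c r) N).
        L < (\<Sum>J\<in>{[]::nat list}. SUP j\<in>PiE {..<k} (I c). v j * (\<Prod>r<k. ennreal (y (j r))))}"
      by (intro emeasure_sum_max_disjoint_blocks_ge)
        (simp_all add: v Ifin Idisj)
    also have "(\<Union>r<k. I c r) = {..<p}"
      using c by (auto simp: I_def C_def PiE_iff)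
    also have "emeasure (PiM {..<p} N) {y \<in> space (PiM {..<p} N).
        L < (\<Sum>J\<in>{[]::nat list}. SUP j\<in>PiE {..<k} (I c). v j * (\<Prod>r<k. ennreal (y (j r))))} \<le>
      emeasure (PiM {..<p} N) {y \<in> space (PiM {..<p} N).
        L < (SUP j\<in>W. v j * (\<Prod>r<k. ennreal (y (j r))))}"
    proof (rule emeasure_mono)
      have [measurable]: "(\<lambda>y. SUP j\<in>W. v j * (\<Prod>r<k. ennreal (y (j r)))) \<in> borel_measurable (PiM {..<p} N)"
        by (rule max_monomial_measurable) (use finW in \<open>auto simp: W_def PiE_iff\<close>)
      show "{y \<in> space (PiM {..<p} N). L < (SUP j\<in>W. v j * (\<Prod>r<k. ennreal (y (j r))))}
          \<in> sets (PiM {..<p} N)"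
        by measurable
    next
      have "(SUP j\<in>PiE {..<k} (I c). v j * (\<Prod>r<k. ennreal (y (j r)))) \<le>
          (SUP j\<in>W. v j * (\<Prod>r<k. ennreal (y (j r))))" for y :: "nat \<Rightarrow> real"
        by (rule SUP_subset_mono) (auto simp: IW)
      then show "{y \<in> space (PiM {..<p} N). L < (\<Sum>J\<in>{[]::nat list}.
            SUP j\<in>PiE {..<k} (I c). v j * (\<Prod>r<k. ennreal (y (j r))))}
          \<subseteq> {y \<in> space (PiM {..<p} N). L < (SUP j\<in>W. v j * (\<Prod>r<k. ennreal (y (j r))))}"
        by (auto intro: less_le_trans)
    qed
    finally show False
      using prob by (simp add: W_def)
  qed
  have double_count: "of_nat (k ^ p) * (\<Sum>j\<in>W. g j) = of_nat (k ^ k) * (\<Sum>c\<in>C. \<Sum>j\<in>PiE {..<k} (I c). g j)"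
  proof -
    have "(\<Sum>c\<in>C. \<Sum>j\<in>PiE {..<k} (I c). g j) = (\<Sum>c\<in>C. \<Sum>j\<in>W. if \<forall>r<k. c (j r) = r then g j else 0)"
      by (simp add: IW sum.inter_filter[OF finW])
    also have "\<dots> = (\<Sum>j\<in>W. \<Sum>c\<in>C. if \<forall>r<k. c (j r) = r then g j else 0)"
      by (rule sum.swap)
    also have "\<dots> = (\<Sum>j\<in>W. of_nat (card {c \<in> C. \<forall>r<k. c (j r) = r}) * g j)"
      by (simp add: sum.inter_filter[OF finC, symmetric])
    finally have "of_nat (k ^ k) * (\<Sum>c\<in>C. \<Sum>j\<in>PiE {..<k} (I c). g j) =
        (\<Sum>j\<in>W. of_nat (card {c \<in> C. \<forall>r<k. c (j r) = r} * k ^ k) * g j)"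
      by (simp add: sum_distrib_left mult_ac)
    also have "\<dots> = (\<Sum>j\<in>W. of_nat (k ^ p) * g j)"
    proof (intro sum.cong refl)
      fix j assume j: "j \<in> W"
      show "of_nat (card {c \<in> C. \<forall>r<k. c (j r) = r} * k ^ k) * g j = of_nat (k ^ p) * g j"
      proof (cases "inj_on j {..<k}")
        case True
        show ?thesis
        proof -
          have "j \<in> {..<k} \<rightarrow> {..<p}" using j by (simp add: W_def PiE_def)
          then show ?thesis using card_colourings[OF True] by (simp only: C_def)
        qed
      next
        case False
        then have "g j = 0" using v0 j by (simp add: g_def W_def)
        then show ?thesis by simp
      qed
    qed
    finally show ?thesis by (simp add: sum_distrib_left)
  qed
  have "(\<Sum>c\<in>C. \<Sum>j\<in>PiE {..<k} (I c). g j) \<le> (\<Sum>c\<in>C. 4 ^ k * L)"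
    by (intro sum_mono coloured)
  also have "\<dots> = of_nat (k ^ p) * (4 ^ k * L)"
    by (simp add: C_def card_PiE)
  finally have "of_nat (k ^ k) * (\<Sum>c\<in>C. \<Sum>j\<in>PiE {..<k} (I c). g j) \<le>
      of_nat (k ^ k) * (of_nat (k ^ p) * (4 ^ k * L))"
    by (rule mult_left_mono) simp
  then have "of_nat (k ^ p) * (\<Sum>j\<in>W. g j) \<le> of_nat (k ^ p) * (of_nat (k ^ k) * (4 ^ k * L))"
    unfolding double_count by (simp only: mult.left_commute)
  moreover have "of_nat (k ^ p) \<noteq> (0 :: ennreal)"
    using k by simp
  moreover have "of_nat (k ^ p) \<noteq> (\<top> :: ennreal)"
    by (rule ennreal_of_nat_neq_top)
  ultimately have "(\<Sum>j\<in>W. g j) \<le> of_nat (k ^ k) * (4 ^ k * L)"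
    using ennreal_mult_le_mult_iff by blast
  also have "\<dots> = (4 * of_nat k) ^ k * L"
    by (simp add: power_mult_distrib mult_ac)
  finally show ?thesis
    by (simp only: W_def g_def)
qed

section \<open>Suprema over off-diagonal rectangles\<close>

text \<open>
  The atoms of the finite algebra generated by \<open>\<F>\<close>, described by a labelling \<open>\<tau>\<close> of the points:
  every member of \<open>\<F>\<close> is a union of level sets of \<open>\<tau>\<close>. Each further set contributes one binary
  digit to the label.
\<close>
lemma finite_partition_refining:
  assumes "finite \<F>" "\<F> \<subseteq> sets M"
  shows "\<exists>(p::nat) \<tau>. \<tau> \<in> measurable M (count_space UNIV) \<and> 0 < p \<and> (\<forall>x. \<tau> x < p) \<and>
    (\<forall>F\<in>\<F>. \<forall>x\<in>F. \<forall>y\<in>space M. \<tau> y = \<tau> x \<longrightarrow> y \<in> F)"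
  using assms
proof (induction \<F> rule: finite_induct)
  case empty
  have "(\<lambda>_. 0 :: nat) \<in> measurable M (count_space UNIV)" by simp
  then show ?case by (metis empty_iff zero_less_one)
next
  case (insert G \<F>)
  then obtain p :: nat and \<tau> where [measurable]: "\<tau> \<in> measurable M (count_space UNIV)"
    and p: "0 < p" "\<And>x. \<tau> x < p"
    and sat: "\<And>F x y. F \<in> \<F> \<Longrightarrow> x \<in> F \<Longrightarrow> y \<in> space M \<Longrightarrow> \<tau> y = \<tau> x \<Longrightarrow> y \<in> F"
    by (metis insert_subset)
  have [measurable]: "G \<in> sets M" using insert.prems by auto
  define \<sigma> where "\<sigma> x = (if x \<in> G then 2 * \<tau> x + 1 else 2 * \<tau> x)" for x
  have meas: "\<sigma> \<in> measurable M (count_space UNIV)"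
    unfolding \<sigma>_def by measurable
  have bound: "\<forall>x. \<sigma> x < 2 * p"
  proof
    fix x show "\<sigma> x < 2 * p"
      using p(2)[of x] unfolding \<sigma>_def by (cases "x \<in> G") simp_all
  qed
  have fine: "\<tau> y = \<tau> x \<and> (y \<in> G \<longleftrightarrow> x \<in> G)" if "\<sigma> y = \<sigma> x" for x y
    using that unfolding \<sigma>_def by (cases "x \<in> G"; cases "y \<in> G") (simp_all, presburger+)
  show ?case
  proof -
    have "\<forall>F\<in>insert G \<F>. \<forall>x\<in>F. \<forall>y\<in>space M. \<sigma> y = \<sigma> x \<longrightarrow> y \<in> F"
      using sat fine by blast
    moreover have "0 < 2 * p" using p(1) by simp
    ultimately show ?thesis
      using meas bound by blast
  qed
qed

lemma frechet_rsmD: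
  fixes \<mu> :: "'a measure"
  assumes "frechet_rsm \<alpha> \<mu> P M"
  shows "prob_space P"
    and "\<And>A. A \<in> sets \<mu> \<Longrightarrow> M A \<in> borel_measurable P"
    and "\<And>(n::nat) A. (\<And>i. i < n \<Longrightarrow> A i \<in> sets \<mu>) \<Longrightarrow> disjoint_family_on A {..<n} \<Longrightarrow>
      prob_space.indep_vars P (\<lambda>_. borel) (\<lambda>i. M (A i)) {..<n}"
    and "\<And>A x. A \<in> sets \<mu> \<Longrightarrow> 0 < x \<Longrightarrow> measure P {\<omega> \<in> space P. M A \<omega> \<le> ennreal x} =
      (if emeasure \<mu> A = \<infinity> then 0 else exp (- (measure \<mu> A * x powr (- \<alpha>))))"
    and "\<And>A :: nat \<Rightarrow> 'a set. range A \<subseteq> sets \<mu> \<Longrightarrow> AE \<omega> in P. M (\<Union>j. A j) \<omega> = (SUP j. M (A j) \<omega>)"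
  using assms unfolding frechet_rsm_def by simp_all

locale finite_frechet_rsm = finite_measure \<mu> + Pr: prob_space P
  for \<mu> :: "'a measure" and P :: "'w measure" +
  fixes \<alpha> :: real and M :: "'a set \<Rightarrow> 'w \<Rightarrow> ennreal"
  assumes \<alpha>_pos: "0 < \<alpha>" and rsm: "frechet_rsm \<alpha> \<mu> P M"
begin

lemma rsm_measurable: "A \<in> sets \<mu> \<Longrightarrow> M A \<in> borel_measurable P"
  by (rule frechet_rsmD(2)[OF rsm])

lemma rsm_cdf:
  assumes "A \<in> sets \<mu>" "0 < x"
  shows "Pr.prob {\<omega> \<in> space P. M A \<omega> \<le> ennreal x} = exp (- (measure \<mu> A * x powr (- \<alpha>)))"
  using frechet_rsmD(4)[OF rsm assms] by (simp add: emeasure_finite)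

lemma rsm_mono:
  assumes "A \<in> sets \<mu>" "B \<in> sets \<mu>" "A \<subseteq> B"
  shows "AE \<omega> in P. M A \<omega> \<le> M B \<omega>"
proof -
  \<comment> \<open>The union of the sequence \<open>A, B, B, \<dots>\<close> is \<open>B\<close>.\<close>
  define X where "X n = (if n = 0 then A else B)" for n :: nat
  have X: "(\<Union>n. X n) = B" "range X \<subseteq> sets \<mu>"
    using assms by (auto simp: X_def split: if_splits)
  have "AE \<omega> in P. M B \<omega> = (SUP n. M (X n) \<omega>)"
    using frechet_rsmD(5)[OF rsm X(2)] unfolding X(1) .
  then show ?thesis
  proof eventually_elim
    case (elim \<omega>)
    then show ?case using SUP_upper[of 0 UNIV "\<lambda>n. M (X n) \<omega>"] by (simp add: X_def)
  qed
qed

lemma rsm_prob_top: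
  assumes A: "A \<in> sets \<mu>"
  shows "Pr.prob {\<omega> \<in> space P. M A \<omega> = \<top>} = 0"
proof -
  note [measurable] = rsm_measurable[OF A]
  have "Pr.prob {\<omega> \<in> space P. M A \<omega> = \<top>} \<le> 1 - exp (- (measure \<mu> A * real (Suc n) powr (- \<alpha>)))" for n
  proof -
    have "Pr.prob {\<omega> \<in> space P. M A \<omega> = \<top>} \<le> Pr.prob {\<omega> \<in> space P. \<not> M A \<omega> \<le> ennreal (real (Suc n))}"
      by (intro Pr.finite_measure_mono) (auto simp: top_unique simp del: of_nat_Suc)
    also have "\<dots> = 1 - Pr.prob {\<omega> \<in> space P. M A \<omega> \<le> ennreal (real (Suc n))}"
      by (rule Pr.prob_neg) measurable
    finally show ?thesis
      using rsm_cdf[OF A, of "real (Suc n)"] by simp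
  qed
  moreover have "(\<lambda>n. 1 - exp (- (measure \<mu> A * real (Suc n) powr (- \<alpha>)))) \<longlonglongrightarrow> 1 - exp (- (measure \<mu> A * 0))"
    using \<alpha>_pos
    by (intro tendsto_intros tendsto_neg_powr filterlim_compose[OF filterlim_real_sequentially filterlim_Suc]) auto
  ultimately have "Pr.prob {\<omega> \<in> space P. M A \<omega> = \<top>} \<le> 0"
    by (intro LIMSEQ_le_const[where X = "\<lambda>n. 1 - exp (- (measure \<mu> A * real (Suc n) powr (- \<alpha>)))"]) auto
  then show ?thesis by (simp add: measure_le_0_iff)
qed

text \<open>
  \<open>enn2real\<close> sends an infinite value to 0, which does not alter the law because \<open>M A\<close> is almost
  surely finite for a finite control measure.
\<close>
lemma real_power_cdf_le:
  assumes A: "A \<in> sets \<mu>" and y: "0 < y"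
  shows "emeasure (distr P borel (\<lambda>\<omega>. enn2real (M A \<omega>) powr \<alpha>)) {..y} \<le> ennreal (exp (- (measure \<mu> A / y)))"
proof -
  note [measurable] = rsm_measurable[OF A]
  have "emeasure (distr P borel (\<lambda>\<omega>. enn2real (M A \<omega>) powr \<alpha>)) {..y} =
      Pr.prob {\<omega> \<in> space P. enn2real (M A \<omega>) powr \<alpha> \<le> y}"
    by (subst emeasure_distr) (auto simp: Pr.emeasure_eq_measure vimage_def intro!: arg_cong[where f = Pr.prob])
  also have "Pr.prob {\<omega> \<in> space P. enn2real (M A \<omega>) powr \<alpha> \<le> y} \<le>
      Pr.prob ({\<omega> \<in> space P. M A \<omega> \<le> ennreal (y powr (1 / \<alpha>))} \<union> {\<omega> \<in> space P. M A \<omega> = \<top>})"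
  proof (intro Pr.finite_measure_mono subsetI)
    fix \<omega> assume \<omega>: "\<omega> \<in> {\<omega> \<in> space P. enn2real (M A \<omega>) powr \<alpha> \<le> y}"
    show "\<omega> \<in> {\<omega> \<in> space P. M A \<omega> \<le> ennreal (y powr (1 / \<alpha>))} \<union> {\<omega> \<in> space P. M A \<omega> = \<top>}"
    proof (cases "M A \<omega>")
      case (real r)
      have "(r powr \<alpha>) powr (1 / \<alpha>) \<le> y powr (1 / \<alpha>)"
        using \<omega> real \<alpha>_pos by (intro powr_mono2) auto
      then have "r \<le> y powr (1 / \<alpha>)"
        using \<alpha>_pos real by (simp add: powr_powr)
      then show ?thesis using \<omega> real by (simp add: ennreal_leI)
    qed (use \<omega> in simp)
  qed measurable
  also have "\<dots> \<le> Pr.prob {\<omega> \<in> space P. M A \<omega> \<le> ennreal (y powr (1 / \<alpha>))} + Pr.prob {\<omega> \<in> space P. M A \<omega> = \<top>}"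
    by (intro measure_Un_le) measurable
  also have "\<dots> = exp (- (measure \<mu> A / y))"
    using rsm_cdf[OF A, of "y powr (1 / \<alpha>)"] rsm_prob_top[OF A] y \<alpha>_pos
    by (simp add: powr_powr powr_minus_divide)
  finally show ?thesis by (simp add: ennreal_leI)
qed

text \<open>
  Both sides are expressed through the atoms \<open>B i\<close> of the algebra generated by all sides \<open>R q r\<close>.
  The step function is constant on products of atoms, with value \<open>v j\<close> on \<open>B (j 0) \<times> \<cdots>\<close>. The
  maximum of the \<open>M\<close>-products over rectangles dominates the one over products of atoms because \<open>M\<close>
  is monotone. Disjointness of the sides of each rectangle forces \<open>v j = 0\<close> for tuples \<open>j\<close>
  with a repeated entry.
\<close>
lemma integral_rect_step_le:
  fixes a :: "'q \<Rightarrow> real" and R :: "'q \<Rightarrow> nat \<Rightarrow> 'a set"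
  assumes k: "1 \<le> k" and Q: "finite Q" and a: "\<And>q. q \<in> Q \<Longrightarrow> 0 < a q" and l: "0 \<le> l"
    and R: "\<And>q r. q \<in> Q \<Longrightarrow> r < k \<Longrightarrow> R q r \<in> sets \<mu>"
    and disj: "\<And>q. q \<in> Q \<Longrightarrow> disjoint_family_on (R q) {..<k}"
    and prob: "emeasure P {\<omega> \<in> space P. ennreal l < (SUP q\<in>Q. ennreal (a q) * (\<Prod>r<k. M (R q r) \<omega>))}
      < ennreal (1 / 2) ^ k"
  shows "(\<integral>\<^sup>+x. (SUP q\<in>Q. ennreal (a q powr \<alpha>) * indicator (PiE {..<k} (R q)) x) \<partial>power_measure k \<mu>)
    \<le> (4 * of_nat k) ^ k * ennreal (l powr \<alpha>)"
proof -
  have "finite (\<Union>q\<in>Q. R q ` {..<k})" "(\<Union>q\<in>Q. R q ` {..<k}) \<subseteq> sets \<mu>"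
    using Q R by auto
  from finite_partition_refining[OF this] obtain p :: nat and \<tau> where
    \<tau> [measurable]: "\<tau> \<in> measurable \<mu> (count_space UNIV)" and p: "0 < p" "\<And>x. \<tau> x < p"
    and sat0: "\<forall>F\<in>(\<Union>q\<in>Q. R q ` {..<k}). \<forall>x\<in>F. \<forall>y\<in>space \<mu>. \<tau> y = \<tau> x \<longrightarrow> y \<in> F"
    by blast
  have sat: "y \<in> R q r" if "q \<in> Q" "r < k" "x \<in> R q r" "y \<in> space \<mu>" "\<tau> y = \<tau> x" for q r x y
    using sat0 that by blast
  define B where "B i = \<tau> -` {i} \<inter> space \<mu>" for i
  define J where "J q r = \<tau> ` R q r" for q r
  define W where "W = PiE {..<k} (\<lambda>_. {..<p})"
  define Qs where "Qs j = {q \<in> Q. \<forall>r<k. j r \<in> J q r}" for j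
  define v where "v j = (SUP q\<in>Qs j. ennreal (a q powr \<alpha>))" for j
  define m where "m i = measure \<mu> (B i)" for i
  define Y where "Y i \<omega> = enn2real (M (B i) \<omega>) powr \<alpha>" for i \<omega>
  define N where "N i = distr P borel (Y i)" for i
  have B [measurable]: "B i \<in> sets \<mu>" for i
    unfolding B_def by measurable
  note [measurable] = rsm_measurable[OF B]
  have Y [measurable]: "Y i \<in> borel_measurable P" for i
    unfolding Y_def by measurable
  have finW: "finite W"
    unfolding W_def by (intro finite_PiE) auto
  interpret L: frechet_laws N m
  proof -
    have pN: "prob_space (N i)" for i
      unfolding N_def by (rule Pr.prob_space_distr) measurable
    show "frechet_laws N m"
      by (intro frechet_laws.intro product_prob_spaceI frechet_laws_axioms.intro pN)
        (auto simp: N_def m_def Y_def[abs_def] intro!: real_power_cdf_le)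
  qed
  have vW: "v j = 0" if j: "\<not> inj_on j {..<k}" for j
  proof -
    have "Qs j = {}"
    proof (rule ccontr)
      assume "Qs j \<noteq> {}"
      then obtain q where q: "q \<in> Q" "\<And>r. r < k \<Longrightarrow> j r \<in> J q r"
        by (auto simp: Qs_def)
      from j obtain r s where rs: "r < k" "s < k" "r \<noteq> s" "j r = j s"
        by (auto simp: inj_on_def)
      from q(2)[OF rs(1)] q(2)[OF rs(2)] obtain x y where
        xy: "x \<in> R q r" "y \<in> R q s" "\<tau> x = j r" "\<tau> y = j s"
        by (auto simp: J_def)
      then have "y \<in> R q r"
        using sat[OF q(1) rs(1) xy(1)] R[OF q(1) rs(2)] rs(4) sets.sets_into_space by auto
      moreover have "R q r \<inter> R q s = {}"
        using disjoint_family_onD[OF disj[OF q(1)]] rs by simp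
      ultimately show False
        using xy by blast
    qed
    then show ?thesis by (simp add: v_def bot_ennreal)
  qed
  have AE_le: "AE \<omega> in P. \<forall>q\<in>Q. \<forall>r\<in>{..<k}. \<forall>i\<in>{..<p}. i \<in> J q r \<longrightarrow> M (B i) \<omega> \<le> M (R q r) \<omega>"
  proof (intro AE_finite_allI Q finite_lessThan)
    fix q r i assume "q \<in> Q" "r \<in> {..<k}" "i \<in> {..<p}"
    then show "AE \<omega> in P. i \<in> J q r \<longrightarrow> M (B i) \<omega> \<le> M (R q r) \<omega>"
      using rsm_mono[OF B R[of q r], of i] sat[of q r] by (cases "i \<in> J q r") (auto simp: J_def B_def)
  qed
  have "emeasure (PiM {..<p} N) {y \<in> space (PiM {..<p} N).
      ennreal (l powr \<alpha>) < (SUP j\<in>W. v j * (\<Prod>r<k. ennreal (y (j r))))} < ennreal (1 / 2) ^ k"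
  proof -
    let ?E = "{y \<in> space (PiM {..<p} N). ennreal (l powr \<alpha>) < (SUP j\<in>W. v j * (\<Prod>r<k. ennreal (y (j r))))}"
    have "Pr.indep_vars (\<lambda>_. borel) (\<lambda>i. M (B i)) {..<p}"
      by (intro frechet_rsmD(3)[OF rsm] B) (auto simp: disjoint_family_on_def B_def)
    then have "Pr.indep_vars (\<lambda>_. borel) Y {..<p}"
      unfolding Y_def by (rule Pr.indep_vars_compose2) measurable
    then have law: "distr P (PiM {..<p} (\<lambda>_. borel)) (\<lambda>\<omega>. \<lambda>i\<in>{..<p}. Y i \<omega>) = PiM {..<p} N"
      using p(1) Y by (subst (asm) Pr.indep_vars_iff_distr_eq_PiM) (auto simp: N_def[abs_def])
    have [measurable]: "(\<lambda>y. SUP j\<in>W. v j * (\<Prod>r<k. ennreal (y (j r)))) \<in> borel_measurable (PiM {..<p} N)"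
      by (rule L.max_monomial_measurable) (use finW in \<open>auto simp: W_def PiE_iff\<close>)
    have E: "?E \<in> sets (PiM {..<p} N)"
      by measurable
    have setsN: "sets (PiM {..<p} N) = sets (PiM {..<p} (\<lambda>_. borel))"
      by (intro sets_PiM_cong) (auto simp: N_def)
    have "emeasure (PiM {..<p} N) ?E = emeasure (distr P (PiM {..<p} (\<lambda>_. borel)) (\<lambda>\<omega>. \<lambda>i\<in>{..<p}. Y i \<omega>)) ?E"
      by (simp only: law)
    also have "\<dots> = emeasure P ((\<lambda>\<omega>. \<lambda>i\<in>{..<p}. Y i \<omega>) -` ?E \<inter> space P)"
      by (intro emeasure_distr measurable_restrict Y E[unfolded setsN])
    also have "\<dots> \<le> emeasure P {\<omega> \<in> space P. ennreal l < (SUP q\<in>Q. ennreal (a q) * (\<Prod>r<k. M (R q r) \<omega>))}"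
    proof (rule emeasure_mono_AE)
      have [measurable]: "M (R q r) \<in> borel_measurable P" if "q \<in> Q" "r < k" for q r
        by (rule rsm_measurable[OF R[OF that]])
      have [measurable]: "(\<lambda>\<omega>. SUP q\<in>Q. ennreal (a q) * (\<Prod>r<k. M (R q r) \<omega>)) \<in> borel_measurable P"
      proof (rule borel_measurable_SUP[OF countable_finite[OF Q]])
        fix q assume "q \<in> Q"
        then have "(\<lambda>\<omega>. \<Prod>r<k. M (R q r) \<omega>) \<in> borel_measurable P"
          by (intro borel_measurable_prod_ennreal) auto
        then show "(\<lambda>\<omega>. ennreal (a q) * (\<Prod>r<k. M (R q r) \<omega>)) \<in> borel_measurable P"
          by measurable
      qed
      show "{\<omega> \<in> space P. ennreal l < (SUP q\<in>Q. ennreal (a q) * (\<Prod>r<k. M (R q r) \<omega>))} \<in> sets P"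
        by measurable
      show "AE \<omega> in P. \<omega> \<in> (\<lambda>\<omega>. \<lambda>i\<in>{..<p}. Y i \<omega>) -` ?E \<inter> space P \<longrightarrow>
          \<omega> \<in> {\<omega> \<in> space P. ennreal l < (SUP q\<in>Q. ennreal (a q) * (\<Prod>r<k. M (R q r) \<omega>))}"
        using AE_le
      proof eventually_elim
        case (elim \<omega>)
        show ?case
        proof
          assume \<omega>: "\<omega> \<in> (\<lambda>\<omega>. \<lambda>i\<in>{..<p}. Y i \<omega>) -` ?E \<inter> space P"
          then obtain j where j: "j \<in> W"
            and lt: "ennreal (l powr \<alpha>) < v j * (\<Prod>r<k. ennreal ((\<lambda>i\<in>{..<p}. Y i \<omega>) (j r)))"
            by (auto simp: less_SUP_iff)
          have jp: "j r < p" if "r < k" for r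
            using j that by (auto simp: W_def PiE_iff)
          have "(\<Prod>r<k. ennreal ((\<lambda>i\<in>{..<p}. Y i \<omega>) (j r))) = (\<Prod>r<k. ennreal (Y (j r) \<omega>))"
            using jp by (intro prod.cong) auto
          with lt obtain q where q: "q \<in> Qs j"
            and lt': "ennreal (l powr \<alpha>) < ennreal (a q powr \<alpha>) * (\<Prod>r<k. ennreal (Y (j r) \<omega>))"
            by (auto simp: v_def SUP_mult_right_ennreal less_SUP_iff)
          from q have qQ: "q \<in> Q" and qJ: "\<And>r. r < k \<Longrightarrow> j r \<in> J q r"
            by (auto simp: Qs_def)
          have Y_le: "ennreal (Y (j r) \<omega>) \<le> ennpowr (M (R q r) \<omega>) \<alpha>" if r: "r < k" for r
          proof -
            have "ennreal (Y (j r) \<omega>) \<le> ennpowr (M (B (j r)) \<omega>) \<alpha>"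
              by (simp add: ennpowr_def Y_def)
            also have "\<dots> \<le> ennpowr (M (R q r) \<omega>) \<alpha>"
              using elim qQ r qJ[OF r] jp[OF r] by (simp add: ennpowr_le_iff[OF \<alpha>_pos])
            finally show ?thesis .
          qed
          have "ennpowr (ennreal l) \<alpha> < ennreal (a q powr \<alpha>) * (\<Prod>r<k. ennreal (Y (j r) \<omega>))"
            using lt' l by (simp add: ennpowr_ennreal)
          also have "\<dots> \<le> ennreal (a q powr \<alpha>) * (\<Prod>r<k. ennpowr (M (R q r) \<omega>) \<alpha>)"
            using Y_le by (intro mult_left_mono prod_mono_ennreal) auto
          also have "\<dots> = ennpowr (ennreal (a q) * (\<Prod>r<k. M (R q r) \<omega>)) \<alpha>"
            using a[OF qQ] by (simp add: ennpowr_mult[OF \<alpha>_pos] ennpowr_prod[OF \<alpha>_pos] ennpowr_ennreal)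
          finally have "ennreal l < ennreal (a q) * (\<Prod>r<k. M (R q r) \<omega>)"
            by (simp add: ennpowr_less_iff[OF \<alpha>_pos])
          then show "\<omega> \<in> {\<omega> \<in> space P. ennreal l < (SUP q\<in>Q. ennreal (a q) * (\<Prod>r<k. M (R q r) \<omega>))}"
            using \<omega> qQ by (auto simp: less_SUP_iff)
        qed
      qed
    qed
    also note prob
    finally show ?thesis .
  qed
  then have bound: "(\<Sum>j\<in>W. v j * (\<Prod>r<k. ennreal (m (j r)))) \<le> (4 * of_nat k) ^ k * ennreal (l powr \<alpha>)"
    unfolding W_def
  proof (intro L.sum_le_of_prob_max_less k)
    show "v j < \<top>" for j
      unfolding v_def by (rule finite_SUP_less_top) (use Q in \<open>auto simp: Qs_def\<close>)
  qed (auto intro: vW)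
  have step: "(SUP q\<in>Q. ennreal (a q powr \<alpha>) * indicator (PiE {..<k} (R q)) x) =
      (\<Sum>j\<in>W. v j * indicator (PiE {..<k} (\<lambda>r. B (j r))) x)" if x: "x \<in> space (power_measure k \<mu>)" for x
  proof -
    define j0 where "j0 = (\<lambda>r\<in>{..<k}. \<tau> (x r))"
    have j0: "j0 \<in> W"
      using p by (auto simp: j0_def W_def)
    have xE: "x \<in> extensional {..<k}" "\<And>r. r < k \<Longrightarrow> x r \<in> space \<mu>"
      using x by (auto simp: space_PiM PiE_iff)
    have xB: "x \<in> PiE {..<k} (\<lambda>r. B (j r)) \<longleftrightarrow> j = j0" if "j \<in> W" for j
    proof
      assume "x \<in> PiE {..<k} (\<lambda>r. B (j r))"
      then show "j = j0"
        using that by (intro extensionalityI[of j "{..<k}" j0]) (auto simp: j0_def W_def PiE_iff B_def)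
    qed (use xE in \<open>auto simp: j0_def PiE_iff B_def\<close>)
    have xR: "x \<in> PiE {..<k} (R q) \<longleftrightarrow> q \<in> Qs j0" if q: "q \<in> Q" for q
    proof
      assume "q \<in> Qs j0"
      then have "\<tau> (x r) \<in> \<tau> ` R q r" if "r < k" for r
        using that by (auto simp: Qs_def j0_def J_def)
      then have "x r \<in> R q r" if "r < k" for r
        using sat[OF q that _ xE(2)[OF that]] that by blast
      then show "x \<in> PiE {..<k} (R q)"
        using xE by (simp add: PiE_iff)
    qed (use q in \<open>auto simp: Qs_def j0_def J_def PiE_iff\<close>)
    have "(\<Sum>j\<in>W. v j * indicator (PiE {..<k} (\<lambda>r. B (j r))) x) = (\<Sum>j\<in>W. if j = j0 then v j else 0)"
      by (intro sum.cong refl) (simp add: indicator_def xB)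
    also have "\<dots> = v j0"
      using j0 finW by simp
    also have "v j0 = (SUP q\<in>Q. ennreal (a q powr \<alpha>) * indicator (PiE {..<k} (R q)) x)"
    proof (rule antisym)
      show "v j0 \<le> (SUP q\<in>Q. ennreal (a q powr \<alpha>) * indicator (PiE {..<k} (R q)) x)"
        unfolding v_def
      proof (rule SUP_least)
        fix q assume q: "q \<in> Qs j0"
        then have qQ: "q \<in> Q" by (simp add: Qs_def)
        show "ennreal (a q powr \<alpha>) \<le> (SUP q\<in>Q. ennreal (a q powr \<alpha>) * indicator (PiE {..<k} (R q)) x)"
          using SUP_upper[OF qQ, of "\<lambda>q. ennreal (a q powr \<alpha>) * indicator (PiE {..<k} (R q)) x"] xR[OF qQ] q
          by simp
      qed
      show "(SUP q\<in>Q. ennreal (a q powr \<alpha>) * indicator (PiE {..<k} (R q)) x) \<le> v j0"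
      proof (rule SUP_least)
        fix q assume q: "q \<in> Q"
        show "ennreal (a q powr \<alpha>) * indicator (PiE {..<k} (R q)) x \<le> v j0"
          using SUP_upper[of q "Qs j0" "\<lambda>q. ennreal (a q powr \<alpha>)"] xR[OF q]
          by (cases "q \<in> Qs j0") (simp_all add: v_def)
      qed
    qed
    finally show ?thesis by simp
  qed
  interpret S: product_sigma_finite "\<lambda>_::nat. \<mu>"
    by unfold_locales
  have "(\<integral>\<^sup>+x. (SUP q\<in>Q. ennreal (a q powr \<alpha>) * indicator (PiE {..<k} (R q)) x) \<partial>power_measure k \<mu>) =
      (\<integral>\<^sup>+x. (\<Sum>j\<in>W. v j * indicator (PiE {..<k} (\<lambda>r. B (j r))) x) \<partial>power_measure k \<mu>)"
    by (intro nn_integral_cong step)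
  also have "\<dots> = (\<Sum>j\<in>W. v j * emeasure (power_measure k \<mu>) (PiE {..<k} (\<lambda>r. B (j r))))"
    by (subst nn_integral_sum) (auto simp: nn_integral_cmult_indicator intro!: sets_PiM_I_finite)
  also have "\<dots> = (\<Sum>j\<in>W. v j * (\<Prod>r<k. ennreal (m (j r))))"
    by (simp add: S.emeasure_PiM m_def emeasure_eq_measure)
  also note bound
  finally show ?thesis .
qed

end

section \<open>Simple integrands for a finite control measure\<close>

lemma offdiag_rects_subset: "offdiag_rects k \<mu> \<subseteq> offdiag_sets k \<mu>"
proof
  fix B assume "B \<in> offdiag_rects k \<mu>"
  then obtain A where B: "B = PiE {..<k} A" and A: "\<And>i. i < k \<Longrightarrow> A i \<in> sets \<mu>"
    and disj: "disjoint_family_on A {..<k}"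
    by (auto simp: offdiag_rects_def)
  have B_sets: "B \<in> sets (power_measure k \<mu>)"
    unfolding B using A by (intro sets_PiM_I_finite) auto
  have "x i \<noteq> x j" if "x \<in> B" "i < k" "j < k" "i \<noteq> j" for x i j
  proof -
    have "x i \<in> A i" "x j \<in> A j"
      using that by (auto simp: B PiE_iff)
    moreover have "A i \<inter> A j = {}"
      using disjoint_family_onD[OF disj] that by simp
    ultimately show ?thesis by auto
  qed
  then have "B = B \<inter> offdiag_space k \<mu>"
    using sets.sets_into_space[OF B_sets] by (fastforce simp: offdiag_space_def diag_space_def)
  then show "B \<in> offdiag_sets k \<mu>"
    unfolding offdiag_sets_def using B_sets by blast
qed

lemma offdiag_sets_UN:
  assumes "finite X" "\<And>b. b \<in> X \<Longrightarrow> B b \<in> offdiag_sets k \<mu>"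
  shows "(\<Union>b\<in>X. B b) \<in> offdiag_sets k \<mu>"
proof -
  have "\<forall>b\<in>X. \<exists>A. A \<in> sets (power_measure k \<mu>) \<and> B b = A \<inter> offdiag_space k \<mu>"
    using assms(2) unfolding offdiag_sets_def by blast
  then obtain A where A: "\<And>b. b \<in> X \<Longrightarrow> A b \<in> sets (power_measure k \<mu>)"
    "\<And>b. b \<in> X \<Longrightarrow> B b = A b \<inter> offdiag_space k \<mu>"
    by metis
  have "(\<Union>b\<in>X. A b) \<in> sets (power_measure k \<mu>)"
    using A(1) assms(1) by (intro sets.finite_UN) auto
  moreover have "(\<Union>b\<in>X. B b) = (\<Union>b\<in>X. A b) \<inter> offdiag_space k \<mu>"
    using A(2) by blast
  ultimately show ?thesis
    unfolding offdiag_sets_def by blast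
qed

lemma offdiag_rect_unions_subset: "offdiag_rect_unions k \<mu> \<subseteq> offdiag_sets k \<mu>"
proof
  fix C assume "C \<in> offdiag_rect_unions k \<mu>"
  then obtain m :: nat and B where "C = (\<Union>i<m. B i)" "\<forall>i<m. B i \<in> offdiag_rects k \<mu>"
    by (auto simp: offdiag_rect_unions_def)
  then show "C \<in> offdiag_sets k \<mu>"
    using offdiag_rects_subset[of k \<mu>] by (auto intro!: offdiag_sets_UN)
qed

text \<open>
  The diagonal is measurable because a Borel isomorphism embeds the space into the reals, where
  equality of two coordinates is a measurable condition.
\<close>
lemma offdiag_sets_measurable:
  assumes "is_borel_space \<mu>"
  shows "offdiag_sets k \<mu> \<subseteq> sets (power_measure k \<mu>)"
proof -
  obtain B \<phi> \<psi> where "\<phi> \<in> measurable \<mu> (restrict_space (borel :: real measure) B)"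
    and inv: "\<forall>x\<in>space \<mu>. \<psi> (\<phi> x) = x"
    using assms unfolding is_borel_space_def by blast
  then have [measurable]: "\<phi> \<in> borel_measurable \<mu>"
    by (simp add: measurable_restrict_space2_iff)
  have inj: "x = y \<longleftrightarrow> \<phi> x = \<phi> y" if "x \<in> space \<mu>" "y \<in> space \<mu>" for x y
    using inv that by metis
  have "diag_space k \<mu> = (\<Union>i\<in>{..<k}. \<Union>j\<in>{..<k} - {i}. {x \<in> space (power_measure k \<mu>). \<phi> (x i) = \<phi> (x j)})"
    (is "?l = ?r")
  proof (intro set_eqI iffI)
    fix x assume "x \<in> ?r"
    then obtain i j where "i < k" "j < k" "i \<noteq> j" "x \<in> space (power_measure k \<mu>)" "\<phi> (x i) = \<phi> (x j)"
      by auto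
    moreover from this have "x i = x j"
      using inj[of "x i" "x j"] by (simp add: space_PiM PiE_iff)
    ultimately show "x \<in> ?l" by (auto simp: diag_space_def)
  next
    fix x assume "x \<in> ?l"
    then obtain i j where "i < k" "j < k" "i \<noteq> j" "x \<in> space (power_measure k \<mu>)" "x i = x j"
      by (auto simp: diag_space_def)
    then show "x \<in> ?r"
      by (intro UN_I[of i] UN_I[of j]) auto
  qed
  also have "\<dots> \<in> sets (power_measure k \<mu>)"
  proof (intro sets.finite_UN finite_lessThan finite_Diff)
    fix i j assume "i \<in> {..<k}" "j \<in> {..<k} - {i}"
    then have "i \<in> {..<k}" "j \<in> {..<k}" by auto
    then have [measurable]: "(\<lambda>x. \<phi> (x i)) \<in> borel_measurable (power_measure k \<mu>)"
      "(\<lambda>x. \<phi> (x j)) \<in> borel_measurable (power_measure k \<mu>)"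
      by measurable
    show "{x \<in> space (power_measure k \<mu>). \<phi> (x i) = \<phi> (x j)} \<in> sets (power_measure k \<mu>)"
      by measurable
  qed
  finally have "offdiag_space k \<mu> \<in> sets (power_measure k \<mu>)"
    unfolding offdiag_space_def by blast
  then show ?thesis
    unfolding offdiag_sets_def by blast
qed

lemma product_rsm_finiteD:
  fixes \<mu> :: "'a measure"
  assumes "product_rsm_finite \<alpha> k \<mu> P M N"
  shows "\<And>A. A \<in> offdiag_sets k \<mu> \<Longrightarrow> N A \<in> borel_measurable P"
    and "\<And>A. (\<And>i. i < k \<Longrightarrow> A i \<in> sets \<mu>) \<Longrightarrow> disjoint_family_on A {..<k} \<Longrightarrow>
      AE \<omega> in P. N (PiE {..<k} A) \<omega> = (\<Prod>i<k. M (A i) \<omega>)"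
    and "\<And>(n::nat) B. (\<And>i. i < n \<Longrightarrow> B i \<in> offdiag_rects k \<mu>) \<Longrightarrow>
      AE \<omega> in P. N (\<Union>i<n. B i) \<omega> = (SUP i\<in>{..<n}. N (B i) \<omega>)"
    and "\<And>A. A \<in> offdiag_sets k \<mu> \<Longrightarrow> \<exists>C::nat \<Rightarrow> (nat \<Rightarrow> 'a) set.
      range C \<subseteq> offdiag_rect_unions k \<mu> \<and>
      (\<lambda>n. emeasure (power_measure k \<mu>) ((C n - A) \<union> (A - C n))) \<longlonglongrightarrow> 0 \<and>
      (\<forall>\<gamma>. 0 < \<gamma> \<and> \<gamma> < \<alpha> \<longrightarrow> Lgamma_tendsto \<gamma> P (\<lambda>n. N (C n)) (N A))"
  using assms unfolding product_rsm_finite_def by simp_all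

context finite_frechet_rsm
begin

text \<open>A supremum over finite unions of rectangles is almost surely one over all the rectangles.\<close>
lemma integral_rect_union_step_le:
  fixes a :: "nat \<Rightarrow> real"
  assumes k: "1 \<le> k" and N: "product_rsm_finite \<alpha> k \<mu> P M N"
    and a: "\<And>i. i < n \<Longrightarrow> 0 < a i" and l: "0 \<le> l"
    and C: "\<And>i. i < n \<Longrightarrow> C i \<in> offdiag_rect_unions k \<mu>"
    and prob: "emeasure P {\<omega> \<in> space P. ennreal l < (SUP i\<in>{..<n}. ennreal (a i) * N (C i) \<omega>)}
      < ennreal (1 / 2) ^ k"
  shows "(\<integral>\<^sup>+x. (SUP i\<in>{..<n}. ennreal (a i powr \<alpha>) * indicator (C i) x) \<partial>power_measure k \<mu>)
    \<le> (4 * of_nat k) ^ k * ennreal (l powr \<alpha>)"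
proof -
  have "\<exists>(s::nat) R. C i = (\<Union>b<s. PiE {..<k} (R b)) \<and>
      (\<forall>b<s. (\<forall>r<k. R b r \<in> sets \<mu>) \<and> disjoint_family_on (R b) {..<k})" if i: "i < n" for i
  proof -
    from C[OF i] obtain s :: nat and B where s: "C i = (\<Union>b<s. B b)" "\<And>b. b < s \<Longrightarrow> B b \<in> offdiag_rects k \<mu>"
      unfolding offdiag_rect_unions_def by blast
    then have "\<exists>R. B b = PiE {..<k} R \<and> (\<forall>r<k. R r \<in> sets \<mu>) \<and> disjoint_family_on R {..<k}" if "b < s" for b
      using that unfolding offdiag_rects_def by blast
    then obtain R where R: "\<And>b. b < s \<Longrightarrow> B b = PiE {..<k} (R b) \<and> (\<forall>r<k. R b r \<in> sets \<mu>) \<and> disjoint_family_on (R b) {..<k}"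
      by metis
    have "C i = (\<Union>b<s. PiE {..<k} (R b))"
      unfolding s(1) by (intro SUP_cong refl) (use R in auto)
    with R show ?thesis by blast
  qed
  then obtain s :: "nat \<Rightarrow> nat" and R where
    CR: "\<And>i. i < n \<Longrightarrow> C i = (\<Union>b<s i. PiE {..<k} (R i b))"
    and R: "\<And>i b r. i < n \<Longrightarrow> b < s i \<Longrightarrow> r < k \<Longrightarrow> R i b r \<in> sets \<mu>"
    and disj: "\<And>i b. i < n \<Longrightarrow> b < s i \<Longrightarrow> disjoint_family_on (R i b) {..<k}"
    by metis
  define Q where "Q = (SIGMA i:{..<n}. {..<s i})"
  have rect: "PiE {..<k} (R i b) \<in> offdiag_rects k \<mu>" if "i < n" "b < s i" for i b
    unfolding offdiag_rects_def using R disj that by blast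
  have N_rect: "AE \<omega> in P. \<forall>q\<in>Q. N (PiE {..<k} (R (fst q) (snd q))) \<omega> = (\<Prod>r<k. M (R (fst q) (snd q) r) \<omega>)"
  proof (rule AE_finite_allI)
    fix q assume "q \<in> Q"
    then have "(\<forall>r<k. R (fst q) (snd q) r \<in> sets \<mu>) \<and> disjoint_family_on (R (fst q) (snd q)) {..<k}"
      using R disj by (auto simp: Q_def)
    then show "AE \<omega> in P. N (PiE {..<k} (R (fst q) (snd q))) \<omega> = (\<Prod>r<k. M (R (fst q) (snd q) r) \<omega>)"
      by (intro product_rsm_finiteD(2)[OF N]) auto
  qed (simp add: Q_def)
  have N_union: "AE \<omega> in P. \<forall>i\<in>{..<n}. N (C i) \<omega> = (SUP b\<in>{..<s i}. N (PiE {..<k} (R i b)) \<omega>)"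
  proof (rule AE_finite_allI)
    fix i assume i: "i \<in> {..<n}"
    have "AE \<omega> in P. N (\<Union>b<s i. PiE {..<k} (R i b)) \<omega> = (SUP b\<in>{..<s i}. N (PiE {..<k} (R i b)) \<omega>)"
      using rect i by (intro product_rsm_finiteD(3)[OF N]) simp
    then show "AE \<omega> in P. N (C i) \<omega> = (SUP b\<in>{..<s i}. N (PiE {..<k} (R i b)) \<omega>)"
      using CR[of i] i by simp
  qed simp
  have [measurable]: "N (C i) \<in> borel_measurable P" if "i < n" for i
    using C[OF that] offdiag_rect_unions_subset[of k \<mu>] by (intro product_rsm_finiteD(1)[OF N]) auto
  have [measurable]: "(\<lambda>\<omega>. SUP i\<in>{..<n}. ennreal (a i) * N (C i) \<omega>) \<in> borel_measurable P"
    by (rule borel_measurable_SUP) (auto intro!: borel_measurable_times)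
  have "emeasure P {\<omega> \<in> space P. ennreal l < (SUP q\<in>Q. ennreal (a (fst q)) * (\<Prod>r<k. M (R (fst q) (snd q) r) \<omega>))}
      \<le> emeasure P {\<omega> \<in> space P. ennreal l < (SUP i\<in>{..<n}. ennreal (a i) * N (C i) \<omega>)}"
  proof (rule emeasure_mono_AE)
    show "{\<omega> \<in> space P. ennreal l < (SUP i\<in>{..<n}. ennreal (a i) * N (C i) \<omega>)} \<in> sets P"
      by measurable
    show "AE \<omega> in P. \<omega> \<in> {\<omega> \<in> space P. ennreal l < (SUP q\<in>Q. ennreal (a (fst q)) * (\<Prod>r<k. M (R (fst q) (snd q) r) \<omega>))} \<longrightarrow>
        \<omega> \<in> {\<omega> \<in> space P. ennreal l < (SUP i\<in>{..<n}. ennreal (a i) * N (C i) \<omega>)}"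
      using N_rect N_union
    proof eventually_elim
      case (elim \<omega>)
      show ?case
      proof
        assume \<omega>: "\<omega> \<in> {\<omega> \<in> space P. ennreal l < (SUP q\<in>Q. ennreal (a (fst q)) * (\<Prod>r<k. M (R (fst q) (snd q) r) \<omega>))}"
        then obtain q where q: "q \<in> Q" and lt: "ennreal l < ennreal (a (fst q)) * (\<Prod>r<k. M (R (fst q) (snd q) r) \<omega>)"
          by (auto simp: less_SUP_iff)
        have q': "fst q < n" "snd q < s (fst q)" using q by (auto simp: Q_def)
        have "(\<Prod>r<k. M (R (fst q) (snd q) r) \<omega>) = N (PiE {..<k} (R (fst q) (snd q))) \<omega>"
          using elim(1) q by simp
        also have "\<dots> \<le> (SUP b\<in>{..<s (fst q)}. N (PiE {..<k} (R (fst q) b)) \<omega>)"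
          using SUP_upper[of "snd q" "{..<s (fst q)}" "\<lambda>b. N (PiE {..<k} (R (fst q) b)) \<omega>"] q' by simp
        also have "\<dots> = N (C (fst q)) \<omega>"
          using elim(2) q' by simp
        finally have "ennreal l < ennreal (a (fst q)) * N (C (fst q)) \<omega>"
          using lt by (meson less_le_trans mult_left_mono zero_le)
        then show "\<omega> \<in> {\<omega> \<in> space P. ennreal l < (SUP i\<in>{..<n}. ennreal (a i) * N (C i) \<omega>)}"
          using \<omega> q' by (auto simp: less_SUP_iff)
      qed
    qed
  qed
  also note prob
  finally have bound: "(\<integral>\<^sup>+x. (SUP q\<in>Q. ennreal (a (fst q) powr \<alpha>) * indicator (PiE {..<k} (R (fst q) (snd q))) x) \<partial>power_measure k \<mu>)
    \<le> (4 * of_nat k) ^ k * ennreal (l powr \<alpha>)"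
    using a R disj l by (intro integral_rect_step_le[OF k]) (auto simp: Q_def)
  have "(SUP i\<in>{..<n}. ennreal (a i powr \<alpha>) * indicator (C i) x) \<le>
      (SUP q\<in>Q. ennreal (a (fst q) powr \<alpha>) * indicator (PiE {..<k} (R (fst q) (snd q))) x)" for x
  proof (rule SUP_least)
    fix i assume i: "i \<in> {..<n}"
    show "ennreal (a i powr \<alpha>) * indicator (C i) x \<le>
      (SUP q\<in>Q. ennreal (a (fst q) powr \<alpha>) * indicator (PiE {..<k} (R (fst q) (snd q))) x)"
    proof (cases "x \<in> C i")
      case True
      then obtain b where b: "b < s i" "x \<in> PiE {..<k} (R i b)"
        using CR i by auto
      have "(i, b) \<in> Q" using i b by (simp add: Q_def)
      from SUP_upper[OF this, of "\<lambda>q. ennreal (a (fst q) powr \<alpha>) * indicator (PiE {..<k} (R (fst q) (snd q))) x"]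
      show ?thesis using b True by simp
    qed simp
  qed
  then show ?thesis
    using bound by (meson nn_integral_mono order_trans)
qed

text \<open>
  The sets \<open>A i\<close> are replaced by approximating unions \<open>C i h\<close> of rectangles. Convergence in
  \<open>L^\<gamma>\<close> gives convergence in probability, so that the supremum for the \<open>C i h\<close> exceeds \<open>l + 1\<close>
  with probability less than \<open>2^-k\<close> once \<open>h\<close> is large: the unit between \<open>l\<close> and \<open>l + 1\<close> absorbs the
  approximation error. The \<open>C i h\<close> may overlap, but at a point of \<open>A i\<close> the integrand is bounded by
  their maximum plus the contribution of the symmetric differences, which vanishes in the limit.
\<close>
lemma integral_simple_le_finite:
  fixes a :: "nat \<Rightarrow> real"
  assumes k: "1 \<le> k" and N: "product_rsm_finite \<alpha> k \<mu> P M N"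
    and offdiag: "offdiag_sets k \<mu> \<subseteq> sets (power_measure k \<mu>)"
    and a: "\<And>i. i < n \<Longrightarrow> 0 < a i" and l: "0 \<le> l"
    and A: "\<And>i. i < n \<Longrightarrow> A i \<in> offdiag_sets k \<mu>"
    and disj: "disjoint_family_on A {..<n}"
    and prob: "emeasure P {\<omega> \<in> space P. ennreal l < (SUP i\<in>{..<n}. ennreal (a i) * N (A i) \<omega>)}
      < ennreal (1 / 2) ^ k"
  shows "(\<integral>\<^sup>+x. (\<Sum>i<n. ennreal (a i powr \<alpha>) * indicator (A i) x) \<partial>power_measure k \<mu>)
    \<le> (4 * of_nat k) ^ k * ennreal ((l + 1) powr \<alpha>)"
proof -
  have "\<exists>C. \<forall>i\<in>{..<n}. range (C i) \<subseteq> offdiag_rect_unions k \<mu> \<and>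
      (\<lambda>h::nat. emeasure (power_measure k \<mu>) ((C i h - A i) \<union> (A i - C i h))) \<longlonglongrightarrow> 0 \<and>
      (\<forall>\<gamma>. 0 < \<gamma> \<and> \<gamma> < \<alpha> \<longrightarrow> Lgamma_tendsto \<gamma> P (\<lambda>h. N (C i h)) (N (A i)))"
    by (intro bchoice ballI product_rsm_finiteD(4)[OF N A]) simp
  then obtain C where C'': "\<forall>i\<in>{..<n}. range (C i) \<subseteq> offdiag_rect_unions k \<mu> \<and>
      (\<lambda>h::nat. emeasure (power_measure k \<mu>) ((C i h - A i) \<union> (A i - C i h))) \<longlonglongrightarrow> 0 \<and>
      (\<forall>\<gamma>. 0 < \<gamma> \<and> \<gamma> < \<alpha> \<longrightarrow> Lgamma_tendsto \<gamma> P (\<lambda>h. N (C i h)) (N (A i)))"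
    by (rule exE)
  note C' = bspec[OF C'', OF lessThan_iff[THEN iffD2]]
  have C: "C i h \<in> offdiag_rect_unions k \<mu>" if "i < n" for i h
    using C'[OF that] by (simp add: range_subsetD)
  have C_lim: "(\<lambda>h. emeasure (power_measure k \<mu>) ((C i h - A i) \<union> (A i - C i h))) \<longlonglongrightarrow> 0" if "i < n" for i
    using C'[OF that] by simp
  have L_lim: "Lgamma_tendsto \<gamma> P (\<lambda>h. N (C i h)) (N (A i))" if "i < n" "0 < \<gamma>" "\<gamma> < \<alpha>" for i \<gamma>
    using C'[OF that(1)] that by simp
  have C_off: "C i h \<in> offdiag_sets k \<mu>" if "i < n" for i h
    using C[OF that] offdiag_rect_unions_subset[of k \<mu>] by blast
  have N_meas: "B \<in> offdiag_sets k \<mu> \<Longrightarrow> N B \<in> borel_measurable P" for B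
    by (rule product_rsm_finiteD(1)[OF N])
  have [measurable]: "N (A i) \<in> borel_measurable P" "N (C i h) \<in> borel_measurable P" if "i < n" for i h
    using N_meas[OF A[OF that]] N_meas[OF C_off[OF that]] by auto
  have A_sets [measurable]: "A i \<in> sets (power_measure k \<mu>)" and C_sets [measurable]: "C i h \<in> sets (power_measure k \<mu>)"
    if "i < n" for i h
    using A[OF that] C_off[OF that] offdiag by auto
  define d where "d i h \<omega> = (N (C i h) \<omega> - N (A i) \<omega>) + (N (A i) \<omega> - N (C i h) \<omega>)" for i h \<omega>
  have d_meas [measurable]: "d i h \<in> borel_measurable P" if "i < n" for i h
    unfolding d_def using that by measurable
  define Bad where "Bad i h = {\<omega> \<in> space P. 1 \<le> ennreal (a i) * d i h \<omega>}" for i h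
  have Bad_sets [measurable]: "Bad i h \<in> sets P" if "i < n" for i h
    unfolding Bad_def using that by measurable
  have Bad_lim: "(\<lambda>h. emeasure P (Bad i h)) \<longlonglongrightarrow> 0" if i: "i < n" for i
  proof -
    \<comment> \<open>Any exponent strictly between 0 and \<open>\<alpha>\<close> would do.\<close>
    let ?g = "\<alpha> / 2"
    have g: "0 < ?g" "?g < \<alpha>" using \<alpha>_pos by auto
    have le: "emeasure P (Bad i h) \<le> ennpowr (ennreal (a i)) ?g * (\<integral>\<^sup>+\<omega>. ennpowr (d i h \<omega>) ?g \<partial>P)" for h
    proof -
      have [measurable]: "(\<lambda>\<omega>. ennpowr (d i h \<omega>) ?g) \<in> borel_measurable P"
        using d_meas[OF i] by (rule measurable_compose) measurable
      have one_le: "1 \<le> x \<longleftrightarrow> 1 \<le> ennpowr x ?g" for x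
        using ennpowr_le_iff[OF g(1), of 1 x] ennpowr_ennreal[of 1 ?g] by simp
      have "Bad i h = {\<omega> \<in> space P. 1 \<le> ennpowr (ennreal (a i)) ?g * ennpowr (d i h \<omega>) ?g}"
        unfolding Bad_def ennpowr_mult[OF g(1), symmetric]
        by (intro Collect_cong conj_cong refl one_le)
      also have "emeasure P \<dots> \<le> ennpowr (ennreal (a i)) ?g * (\<integral>\<^sup>+\<omega>. ennpowr (d i h \<omega>) ?g * indicator (space P) \<omega> \<partial>P)"
        by (rule nn_integral_Markov_inequality) simp_all
      also have "(\<integral>\<^sup>+\<omega>. ennpowr (d i h \<omega>) ?g * indicator (space P) \<omega> \<partial>P) = (\<integral>\<^sup>+\<omega>. ennpowr (d i h \<omega>) ?g \<partial>P)"
        by (intro nn_integral_cong) simp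
      finally show ?thesis .
    qed
    have "(\<lambda>h. ennpowr (ennreal (a i)) ?g * (\<integral>\<^sup>+\<omega>. ennpowr (d i h \<omega>) ?g \<partial>P)) \<longlonglongrightarrow> ennpowr (ennreal (a i)) ?g * 0"
      using L_lim[OF i g] a[OF i] unfolding Lgamma_tendsto_def d_def
      by (intro ennreal_tendsto_cmult) (auto simp: ennpowr_ennreal)
    then have lim: "(\<lambda>h. ennpowr (ennreal (a i)) ?g * (\<integral>\<^sup>+\<omega>. ennpowr (d i h \<omega>) ?g \<partial>P)) \<longlonglongrightarrow> 0"
      by simp
    show ?thesis
      by (rule tendsto_sandwich[OF _ _ tendsto_const lim]) (simp_all add: le)
  qed
  let ?G = "{\<omega> \<in> space P. ennreal l < (SUP i\<in>{..<n}. ennreal (a i) * N (A i) \<omega>)}"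
  have [measurable]: "(\<lambda>\<omega>. SUP i\<in>{..<n}. ennreal (a i) * N (A i) \<omega>) \<in> borel_measurable P"
    by (rule borel_measurable_SUP) (auto intro!: borel_measurable_times)
  have union_le: "emeasure P {\<omega> \<in> space P. ennreal (l + 1) < (SUP i\<in>{..<n}. ennreal (a i) * N (C i h) \<omega>)}
      \<le> emeasure P ?G + (\<Sum>i<n. emeasure P (Bad i h))" for h
  proof -
    have "{\<omega> \<in> space P. ennreal (l + 1) < (SUP i\<in>{..<n}. ennreal (a i) * N (C i h) \<omega>)} \<subseteq> ?G \<union> (\<Union>i<n. Bad i h)"
    proof
      fix \<omega> assume \<omega>: "\<omega> \<in> {\<omega> \<in> space P. ennreal (l + 1) < (SUP i\<in>{..<n}. ennreal (a i) * N (C i h) \<omega>)}"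
      then obtain i where i: "i < n" and lt: "ennreal (l + 1) < ennreal (a i) * N (C i h) \<omega>"
        by (auto simp: less_SUP_iff)
      show "\<omega> \<in> ?G \<union> (\<Union>i<n. Bad i h)"
      proof (cases "\<omega> \<in> Bad i h")
        case False
        then have small: "ennreal (a i) * d i h \<omega> < 1"
          using \<omega> by (simp add: Bad_def)
        have "N (C i h) \<omega> \<le> N (A i) \<omega> + (N (C i h) \<omega> - N (A i) \<omega>)"
          by (cases "N (C i h) \<omega> \<le> N (A i) \<omega>") (auto simp: add_increasing2 add_diff_inverse_ennreal)
        also have "\<dots> \<le> N (A i) \<omega> + d i h \<omega>"
          by (intro add_left_mono) (simp add: d_def)
        finally have "ennreal (a i) * N (C i h) \<omega> \<le> ennreal (a i) * (N (A i) \<omega> + d i h \<omega>)"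
          by (rule mult_left_mono) simp
        also have "\<dots> \<le> ennreal (a i) * N (A i) \<omega> + 1"
          using add_left_mono[OF less_imp_le[OF small], of "ennreal (a i) * N (A i) \<omega>"]
          by (simp only: distrib_left)
        finally have "ennreal (a i) * N (C i h) \<omega> \<le> ennreal (a i) * N (A i) \<omega> + 1" .
        moreover have "ennreal l + 1 < ennreal (a i) * N (C i h) \<omega>"
          using lt l by simp
        ultimately have "ennreal l + 1 < ennreal (a i) * N (A i) \<omega> + 1"
          by (rule less_le_trans[rotated])
        then have "ennreal l < ennreal (a i) * N (A i) \<omega>"
          by (meson add_right_mono not_le)
        then show ?thesis
          using \<omega> i by (auto simp: less_SUP_iff)
      qed (use i in auto)
    qed
    then have "emeasure P {\<omega> \<in> space P. ennreal (l + 1) < (SUP i\<in>{..<n}. ennreal (a i) * N (C i h) \<omega>)}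
        \<le> emeasure P (?G \<union> (\<Union>i<n. Bad i h))"
      using Bad_sets by (intro emeasure_mono sets.Un sets.finite_UN) auto
    also have "\<dots> \<le> emeasure P ?G + emeasure P (\<Union>i<n. Bad i h)"
      using Bad_sets by (intro emeasure_subadditive sets.finite_UN) auto
    also have "\<dots> \<le> emeasure P ?G + (\<Sum>i<n. emeasure P (Bad i h))"
      using Bad_sets by (intro add_left_mono emeasure_subadditive_finite) auto
    finally show ?thesis .
  qed
  have "(\<lambda>h. emeasure P ?G + (\<Sum>i<n. emeasure P (Bad i h))) \<longlonglongrightarrow> emeasure P ?G + (\<Sum>i<n. 0)"
    using Bad_lim by (intro tendsto_add tendsto_const tendsto_sum) auto
  then have "eventually (\<lambda>h. emeasure P ?G + (\<Sum>i<n. emeasure P (Bad i h)) < ennreal (1 / 2) ^ k) sequentially"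
    using prob by (intro order_tendstoD(2)) auto
  then have "eventually (\<lambda>h. (\<integral>\<^sup>+x. (SUP i\<in>{..<n}. ennreal (a i powr \<alpha>) * indicator (C i h) x) \<partial>power_measure k \<mu>)
      \<le> (4 * of_nat k) ^ k * ennreal ((l + 1) powr \<alpha>)) sequentially"
  proof eventually_elim
    case (elim h)
    show ?case
      using a l C le_less_trans[OF union_le elim]
      by (intro integral_rect_union_step_le[OF k N]) auto
  qed
  then have ev: "eventually (\<lambda>h. (\<integral>\<^sup>+x. (\<Sum>i<n. ennreal (a i powr \<alpha>) * indicator (A i) x) \<partial>power_measure k \<mu>)
      \<le> (4 * of_nat k) ^ k * ennreal ((l + 1) powr \<alpha>) +
        (\<Sum>i<n. ennreal (a i powr \<alpha>) * emeasure (power_measure k \<mu>) ((C i h - A i) \<union> (A i - C i h)))) sequentially"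
  proof eventually_elim
    case (elim h)
    have pointwise: "(\<Sum>i<n. ennreal (a i powr \<alpha>) * indicator (A i) x) \<le>
        (SUP i\<in>{..<n}. ennreal (a i powr \<alpha>) * indicator (C i h) x) +
        (\<Sum>i<n. ennreal (a i powr \<alpha>) * indicator ((C i h - A i) \<union> (A i - C i h)) x)" for x
    proof (cases "\<exists>i<n. x \<in> A i")
      case True
      then obtain i where i: "i < n" "x \<in> A i" by blast
      have "x \<notin> A j" if "j < n" "j \<noteq> i" for j
        using disjoint_family_onD[OF disj, of i j] that i by auto
      then have "(\<Sum>j<n. ennreal (a j powr \<alpha>) * indicator (A j) x) = (\<Sum>j<n. if j = i then ennreal (a i powr \<alpha>) else 0)"
        using i by (intro sum.cong) auto
      also have "\<dots> = ennreal (a i powr \<alpha>)"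
        using i by simp
      also have "\<dots> \<le> ennreal (a i powr \<alpha>) * indicator (C i h) x +
          ennreal (a i powr \<alpha>) * indicator ((C i h - A i) \<union> (A i - C i h)) x"
        using i by (cases "x \<in> C i h") auto
      also have "\<dots> \<le> (SUP i\<in>{..<n}. ennreal (a i powr \<alpha>) * indicator (C i h) x) +
        (\<Sum>i<n. ennreal (a i powr \<alpha>) * indicator ((C i h - A i) \<union> (A i - C i h)) x)"
        using i SUP_upper[of i "{..<n}" "\<lambda>i. ennreal (a i powr \<alpha>) * indicator (C i h) x"]
        by (intro add_mono member_le_sum) auto
      finally show ?thesis .
    next
      case False
      then have "(\<Sum>j<n. ennreal (a j powr \<alpha>) * indicator (A j) x) = 0"
        by (intro sum.neutral) auto
      then show ?thesis by simp
    qed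
    have [measurable]: "(\<lambda>x. SUP i\<in>{..<n}. ennreal (a i powr \<alpha>) * indicator (C i h) x) \<in> borel_measurable (power_measure k \<mu>)"
      using C_sets by (intro borel_measurable_SUP borel_measurable_times_ennreal borel_measurable_indicator) auto
    have Dsets: "(C i h - A i) \<union> (A i - C i h) \<in> sets (power_measure k \<mu>)" if "i < n" for i
      using A_sets[OF that] C_sets[OF that] by auto
    have Dm: "(\<lambda>x. ennreal (a i powr \<alpha>) * indicator ((C i h - A i) \<union> (A i - C i h)) x) \<in> borel_measurable (power_measure k \<mu>)"
      if "i < n" for i
      using Dsets[OF that] by (intro borel_measurable_times_ennreal borel_measurable_indicator) auto
    have "(\<integral>\<^sup>+x. (\<Sum>i<n. ennreal (a i powr \<alpha>) * indicator (A i) x) \<partial>power_measure k \<mu>) \<le>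
        (\<integral>\<^sup>+x. (SUP i\<in>{..<n}. ennreal (a i powr \<alpha>) * indicator (C i h) x) +
        (\<Sum>i<n. ennreal (a i powr \<alpha>) * indicator ((C i h - A i) \<union> (A i - C i h)) x) \<partial>power_measure k \<mu>)"
      by (intro nn_integral_mono pointwise)
    also have "\<dots> = (\<integral>\<^sup>+x. (SUP i\<in>{..<n}. ennreal (a i powr \<alpha>) * indicator (C i h) x) \<partial>power_measure k \<mu>) +
        (\<integral>\<^sup>+x. (\<Sum>i<n. ennreal (a i powr \<alpha>) * indicator ((C i h - A i) \<union> (A i - C i h)) x) \<partial>power_measure k \<mu>)"
      using Dm by (intro nn_integral_add borel_measurable_sum) auto
    also have "(\<integral>\<^sup>+x. (\<Sum>i<n. ennreal (a i powr \<alpha>) * indicator ((C i h - A i) \<union> (A i - C i h)) x) \<partial>power_measure k \<mu>) =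
        (\<Sum>i<n. ennreal (a i powr \<alpha>) * emeasure (power_measure k \<mu>) ((C i h - A i) \<union> (A i - C i h)))"
      using Dsets Dm by (subst nn_integral_sum) (auto simp: nn_integral_cmult_indicator)
    finally show ?case
      using elim by (meson add_right_mono order_trans)
  qed
  have "(\<lambda>h. (4 * of_nat k) ^ k * ennreal ((l + 1) powr \<alpha>) +
        (\<Sum>i<n. ennreal (a i powr \<alpha>) * emeasure (power_measure k \<mu>) ((C i h - A i) \<union> (A i - C i h))))
      \<longlonglongrightarrow> (4 * of_nat k) ^ k * ennreal ((l + 1) powr \<alpha>) + (\<Sum>i<n. ennreal (a i powr \<alpha>) * 0)"
    using C_lim by (intro tendsto_add tendsto_const tendsto_sum ennreal_tendsto_cmult) auto
  from tendsto_lowerbound[OF this ev] show ?thesis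
    by simp
qed

end

section \<open>Passage to a sigma-finite control measure\<close>

text \<open>
  Restricting the random sup measure to \<open>E\<close> corresponds to restricting its control measure; this
  makes the results for finite control measures applicable to the pieces of an exhaustion.
\<close>
lemma frechet_rsm_restrict:
  assumes M: "frechet_rsm \<alpha> \<mu> P M" and E: "E \<in> sets \<mu>"
  shows "frechet_rsm \<alpha> (density \<mu> (indicator E)) P (\<lambda>A. M (A \<inter> E))"
  unfolding frechet_rsm_def
proof (intro conjI allI impI ballI)
  show "prob_space P" by (rule frechet_rsmD(1)[OF M])
  fix A assume "A \<in> sets (density \<mu> (indicator E))"
  then have A: "A \<in> sets \<mu>" by simp
  show "M (A \<inter> E) \<in> borel_measurable P"
    using A E by (intro frechet_rsmD(2)[OF M]) auto
  have em: "emeasure (density \<mu> (indicator E)) A = emeasure \<mu> (A \<inter> E)"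
    using emeasure_restricted[OF E A] by (simp add: Int_commute)
  fix x :: real assume "0 < x"
  then have "measure P {\<omega> \<in> space P. M (A \<inter> E) \<omega> \<le> ennreal x} =
      (if emeasure \<mu> (A \<inter> E) = \<infinity> then 0 else exp (- (measure \<mu> (A \<inter> E) * x powr (- \<alpha>))))"
    using A E by (intro frechet_rsmD(4)[OF M]) auto
  then show "measure P {\<omega> \<in> space P. M (A \<inter> E) \<omega> \<le> ennreal x} =
      (if emeasure (density \<mu> (indicator E)) A = \<infinity> then 0
       else exp (- (measure (density \<mu> (indicator E)) A * x powr (- \<alpha>))))"
    unfolding em measure_def .
next
  fix n :: nat and A :: "nat \<Rightarrow> 'a set"
  assume "(\<forall>i<n. A i \<in> sets (density \<mu> (indicator E))) \<and> disjoint_family_on A {..<n}"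
  then show "prob_space.indep_vars P (\<lambda>_. borel) (\<lambda>i. M (A i \<inter> E)) {..<n}"
    using E by (intro frechet_rsmD(3)[OF M]) (auto simp: disjoint_family_on_def)
next
  fix A :: "nat \<Rightarrow> 'a set"
  assume "range A \<subseteq> sets (density \<mu> (indicator E))"
  then have "AE \<omega> in P. M (\<Union>j. A j \<inter> E) \<omega> = (SUP j. M (A j \<inter> E) \<omega>)"
    using E by (intro frechet_rsmD(5)[OF M]) auto
  then show "AE \<omega> in P. M ((\<Union>j. A j) \<inter> E) \<omega> = (SUP j. M (A j \<inter> E) \<omega>)"
    by simp
qed

lemma power_measure_restrict:
  assumes sf: "sigma_finite_measure \<mu>" and E: "E \<in> sets \<mu>" and fin: "emeasure \<mu> E < \<infinity>"
  shows "power_measure k (density \<mu> (indicator E)) =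
    density (power_measure k \<mu>) (indicator (PiE {..<k} (\<lambda>_. E)))"
proof -
  have fm: "finite_measure (density \<mu> (indicator E))"
    using emeasure_restricted[OF E sets.top[of \<mu>]] fin sets.sets_into_space[OF E]
    by (intro finite_measureI) (simp add: Int_absorb2)
  interpret R: product_sigma_finite "\<lambda>_::nat. density \<mu> (indicator E)"
    using fm by (intro product_sigma_finite.intro finite_measure.axioms(1))
  interpret S: product_sigma_finite "\<lambda>_::nat. \<mu>"
    using sf by (intro product_sigma_finite.intro)
  have EE: "PiE {..<k} (\<lambda>_. E) \<in> sets (power_measure k \<mu>)"
    using E by (intro sets_PiM_I_finite) auto
  show ?thesis
  proof (rule R.PiM_eqI[symmetric])
    show "sets (density (power_measure k \<mu>) (indicator (PiE {..<k} (\<lambda>_. E)))) =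
        sets (power_measure k (density \<mu> (indicator E)))"
      by (simp cong: sets_PiM_cong)
    fix A assume A: "\<And>i. i \<in> {..<k} \<Longrightarrow> A i \<in> sets (density \<mu> (indicator E))"
    then have "PiE {..<k} A \<in> sets (power_measure k \<mu>)"
      by (intro sets_PiM_I_finite) auto
    then have "emeasure (density (power_measure k \<mu>) (indicator (PiE {..<k} (\<lambda>_. E)))) (PiE {..<k} A) =
        emeasure (power_measure k \<mu>) (PiE {..<k} (\<lambda>i. E \<inter> A i))"
      using EE by (simp add: emeasure_restricted PiE_Int)
    also have "\<dots> = (\<Prod>i<k. emeasure \<mu> (E \<inter> A i))"
      using A E by (intro S.emeasure_PiM) auto
    also have "\<dots> = (\<Prod>i<k. emeasure (density \<mu> (indicator E)) (A i))"
      using A E by (intro prod.cong) (simp_all add: emeasure_restricted)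
    finally show "emeasure (density (power_measure k \<mu>) (indicator (PiE {..<k} (\<lambda>_. E)))) (PiE {..<k} A) =
        (\<Prod>i<k. emeasure (density \<mu> (indicator E)) (A i))" .
  qed simp
qed

lemma nn_integral_power_le_of_exhaustion:
  fixes E :: "nat \<Rightarrow> 'a set"
  assumes sf: "sigma_finite_measure \<mu>" and E: "range E \<subseteq> sets \<mu>" "incseq E" "(\<Union>n. E n) = space \<mu>"
    and fin: "\<And>n. emeasure \<mu> (E n) < \<infinity>"
    and g [measurable]: "g \<in> borel_measurable (power_measure k \<mu>)"
    and le: "\<And>n. (\<integral>\<^sup>+x. g x \<partial>power_measure k (density \<mu> (indicator (E n)))) \<le> K"
  shows "(\<integral>\<^sup>+x. g x \<partial>power_measure k \<mu>) \<le> K"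
proof -
  define F where "F n = PiE {..<k} (\<lambda>_. E n)" for n
  have F [measurable]: "F n \<in> sets (power_measure k \<mu>)" for n
    unfolding F_def using E by (intro sets_PiM_I_finite) auto
  have E_mono: "E i \<subseteq> E j" if "i \<le> j" for i j
    using E(2) that by (simp add: incseqD)
  have F_mono: "F i \<subseteq> F j" if "i \<le> j" for i j
    unfolding F_def by (intro PiE_mono E_mono that)
  have sup: "g x = (SUP n. indicator (F n) x * g x)" if x: "x \<in> space (power_measure k \<mu>)" for x
  proof -
    have "\<forall>i\<in>{..<k}. \<exists>n. x i \<in> E n"
      using x E(3) by (auto simp: space_PiM PiE_iff)
    then obtain h where h: "\<And>i. i < k \<Longrightarrow> x i \<in> E (h i)"
      by (metis lessThan_iff)
    have "x i \<in> E (Max (insert 0 (h ` {..<k})))" if "i < k" for i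
      using h[OF that] E_mono[of "h i" "Max (insert 0 (h ` {..<k}))"] that by auto
    then have "x \<in> F (Max (insert 0 (h ` {..<k})))"
      using x by (simp add: F_def space_PiM PiE_iff)
    then have "g x \<le> (SUP n. indicator (F n) x * g x)"
      using SUP_upper[of "Max (insert 0 (h ` {..<k}))" UNIV "\<lambda>n. indicator (F n) x * g x"] by simp
    moreover have "(SUP n. indicator (F n) x * g x) \<le> g x"
      by (rule SUP_least) (simp add: indicator_def)
    ultimately show ?thesis by (rule antisym)
  qed
  have "(\<integral>\<^sup>+x. g x \<partial>power_measure k \<mu>) = (\<integral>\<^sup>+x. (SUP n. indicator (F n) x * g x) \<partial>power_measure k \<mu>)"
    by (intro nn_integral_cong sup)
  also have "\<dots> = (SUP n. \<integral>\<^sup>+x. indicator (F n) x * g x \<partial>power_measure k \<mu>)"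
  proof (rule nn_integral_monotone_convergence_SUP)
    have "F n \<subseteq> F (Suc n)" for n
      by (rule F_mono) simp
    then show "incseq (\<lambda>n x. indicator (F n) x * g x)"
      by (intro incseq_SucI le_funI mult_right_mono) (auto simp: indicator_def)
  qed measurable
  also have "\<dots> \<le> K"
  proof (rule SUP_least)
    fix n
    have "(\<integral>\<^sup>+x. indicator (F n) x * g x \<partial>power_measure k \<mu>) =
        (\<integral>\<^sup>+x. g x \<partial>density (power_measure k \<mu>) (indicator (F n)))"
      by (subst nn_integral_density) measurable
    also have "\<dots> = (\<integral>\<^sup>+x. g x \<partial>power_measure k (density \<mu> (indicator (E n))))"
      using power_measure_restrict[OF sf _ fin, of n k] E(1) by (simp add: F_def range_subsetD)
    finally show "(\<integral>\<^sup>+x. indicator (F n) x * g x \<partial>power_measure k \<mu>) \<le> K"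
      using le by simp
  qed
  finally show ?thesis .
qed

text \<open>
  The product random sup measure dominates each of its restrictions to \<open>E h\<close>, so the hypothesis on
  \<open>X\<close> passes to every \<open>E h\<close>. The resulting bound does not depend on \<open>h\<close>, and monotone convergence
  along the exhaustion removes the restriction.
\<close>
lemma integral_simple_le:
  assumes \<alpha>: "0 < \<alpha>" and k: "1 \<le> k" and borel: "is_borel_space \<mu>" and sf: "sigma_finite_measure \<mu>"
    and M: "frechet_rsm \<alpha> \<mu> P M" and N: "product_rsm \<alpha> k \<mu> P M N"
    and X: "simple_extremal_integral k \<mu> P N f X" and l: "0 \<le> l"
    and prob: "emeasure P {\<omega> \<in> space P. ennreal l < X \<omega>} < ennreal (1 / 2) ^ k"
  shows "(\<integral>\<^sup>+x. ennpowr (f x) \<alpha> \<partial>power_measure k \<mu>) \<le> (4 * of_nat k) ^ k * ennreal ((l + 1) powr \<alpha>)"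
proof -
  obtain n :: nat and a :: "nat \<Rightarrow> real" and A where
    X_meas [measurable]: "X \<in> borel_measurable P" and
    aA: "\<forall>i<n. 0 < a i \<and> A i \<in> offdiag_sets k \<mu>" and disj: "disjoint_family_on A {..<n}"
    and f: "\<forall>x\<in>space (power_measure k \<mu>). f x = (\<Sum>i<n. ennreal (a i) * indicator (A i) x)"
    and X_eq: "AE \<omega> in P. X \<omega> = (SUP i\<in>{..<n}. ennreal (a i) * N (A i) \<omega>)"
    using X unfolding simple_extremal_integral_def by blast
  obtain E :: "nat \<Rightarrow> 'a set" and K where
    E: "range E \<subseteq> sets \<mu>" "incseq E" "(\<Union>n. E n) = space \<mu>"
    and E_fin: "\<forall>n. 0 < emeasure \<mu> (E n) \<and> emeasure \<mu> (E n) < \<infinity>"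
    and K: "\<forall>n. product_rsm_finite \<alpha> k (density \<mu> (indicator (E n))) P (\<lambda>A. M (A \<inter> E n)) (K n)"
    and NK: "\<forall>A\<in>offdiag_sets k \<mu>. AE \<omega> in P. N A \<omega> = (SUP n. K n A \<omega>)"
    using N unfolding product_rsm_def by (elim conjE exE)
  have A_off: "A i \<in> offdiag_sets k \<mu>" if "i < n" for i
    using aA that by simp
  have off: "offdiag_sets k \<mu> \<subseteq> sets (power_measure k \<mu>)"
    by (rule offdiag_sets_measurable[OF borel])
  have A_sets [measurable]: "A i \<in> sets (power_measure k \<mu>)" if "i < n" for i
    using off A_off[OF that] by blast
  define g where "g x = (\<Sum>i<n. ennreal (a i powr \<alpha>) * indicator (A i) x)" for x
  have g_meas: "g \<in> borel_measurable (power_measure k \<mu>)"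
    unfolding g_def using A_sets
    by (intro borel_measurable_sum borel_measurable_times_ennreal borel_measurable_indicator) auto
  have fg: "ennpowr (f x) \<alpha> = g x" if x: "x \<in> space (power_measure k \<mu>)" for x
  proof (cases "\<exists>i<n. x \<in> A i")
    case True
    then obtain i where i: "i < n" "x \<in> A i" by blast
    have other: "x \<notin> A j" if "j < n" "j \<noteq> i" for j
      using disjoint_family_onD[OF disj, of i j] that i by auto
    have single: "(\<Sum>j<n. h j * indicator (A j) x) = h i" for h :: "nat \<Rightarrow> ennreal"
    proof -
      have "(\<Sum>j<n. h j * indicator (A j) x) = (\<Sum>j<n. if j = i then h i else 0)"
        using i other by (intro sum.cong) auto
      then show ?thesis using i by simp
    qed
    have "f x = ennreal (a i)"
      using bspec[OF f x] unfolding single .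
    moreover have "g x = ennreal (a i powr \<alpha>)"
      unfolding g_def single ..
    moreover have "0 < a i" using aA i by simp
    ultimately show ?thesis
      by (simp add: ennpowr_ennreal)
  next
    case False
    then have none: "(\<Sum>j<n. h j * indicator (A j) x) = 0" for h :: "nat \<Rightarrow> ennreal"
      by (intro sum.neutral) auto
    show ?thesis
      using bspec[OF f x] unfolding g_def none by (simp add: ennpowr_0)
  qed
  have "(\<integral>\<^sup>+x. g x \<partial>power_measure k (density \<mu> (indicator (E h)))) \<le> (4 * of_nat k) ^ k * ennreal ((l + 1) powr \<alpha>)" for h
  proof -
    let ?\<mu> = "density \<mu> (indicator (E h))"
    have Eh: "E h \<in> sets \<mu>" using E(1) by blast
    have fm: "finite_measure ?\<mu>"
      using emeasure_restricted[OF Eh sets.top[of \<mu>]] E_fin sets.sets_into_space[OF Eh]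
      by (intro finite_measureI) (simp add: Int_absorb2 less_top)
    interpret finite_frechet_rsm ?\<mu> P \<alpha> "\<lambda>A. M (A \<inter> E h)"
      using fm frechet_rsmD(1)[OF M] \<alpha> frechet_rsm_restrict[OF M Eh]
      by (intro finite_frechet_rsm.intro finite_frechet_rsm_axioms.intro)
    have sets_eq: "sets (power_measure k ?\<mu>) = sets (power_measure k \<mu>)"
      by (intro sets_PiM_cong) auto
    have off_eq: "offdiag_sets k ?\<mu> = offdiag_sets k \<mu>"
      using sets_eq sets_eq_imp_space_eq[OF sets_eq]
      by (simp add: offdiag_sets_def offdiag_space_def diag_space_def)
    have Kh: "product_rsm_finite \<alpha> k ?\<mu> P (\<lambda>A. M (A \<inter> E h)) (K h)"
      using K by blast
    have "AE \<omega> in P. \<forall>i\<in>{..<n}. N (A i) \<omega> = (SUP n. K n (A i) \<omega>)"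
      using NK A_off by (intro AE_finite_allI) auto
    then have K_le: "AE \<omega> in P. (SUP i\<in>{..<n}. ennreal (a i) * K h (A i) \<omega>) \<le> X \<omega>"
      using X_eq
    proof eventually_elim
      case (elim \<omega>)
      have "K h (A i) \<omega> \<le> N (A i) \<omega>" if "i < n" for i
        using elim(1) that SUP_upper[of h UNIV "\<lambda>n. K n (A i) \<omega>"] by simp
      then show ?case
        unfolding elim(2) by (intro SUP_subset_mono mult_left_mono) auto
    qed
    have "emeasure P {\<omega> \<in> space P. ennreal l < (SUP i\<in>{..<n}. ennreal (a i) * K h (A i) \<omega>)} \<le>
        emeasure P {\<omega> \<in> space P. ennreal l < X \<omega>}"
      using K_le by (intro emeasure_mono_AE) (auto elim!: eventually_mono)
    also note prob
    finally show ?thesis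
      unfolding g_def using aA l disj off
      by (intro integral_simple_le_finite[OF k Kh]) (auto simp: off_eq sets_eq)
  qed
  then have "(\<integral>\<^sup>+x. g x \<partial>power_measure k \<mu>) \<le> (4 * of_nat k) ^ k * ennreal ((l + 1) powr \<alpha>)"
    using E E_fin by (intro nn_integral_power_le_of_exhaustion[OF sf E _ g_meas]) auto
  also have "(\<integral>\<^sup>+x. g x \<partial>power_measure k \<mu>) = (\<integral>\<^sup>+x. ennpowr (f x) \<alpha> \<partial>power_measure k \<mu>)"
    by (intro nn_integral_cong) (simp add: fg)
  finally show ?thesis .
qed

section \<open>Integrability of the integrand\<close>

text \<open>
  Choose \<open>j\<close> with \<open>P (Y > j) < \<epsilon>\<close>, which is possible since \<open>Y\<close> is almost surely finite. If
  \<open>X i > j + 1\<close> for infinitely many \<open>i\<close>, then almost surely \<open>Y > j\<close>; so the decreasing events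
  \<open>D n\<close> eventually have probability less than \<open>\<epsilon>\<close>.
\<close>
lemma (in prob_space) tight_of_AE_tendsto_finite:
  fixes X :: "nat \<Rightarrow> 'a \<Rightarrow> ennreal"
  assumes X [measurable]: "\<And>n. X n \<in> borel_measurable M" and Y [measurable]: "Y \<in> borel_measurable M"
    and lim: "AE \<omega> in M. (\<lambda>n. X n \<omega>) \<longlonglongrightarrow> Y \<omega>" and fin: "AE \<omega> in M. Y \<omega> < \<infinity>" and \<epsilon>: "0 < \<epsilon>"
  shows "\<exists>l\<ge>0. eventually (\<lambda>n. emeasure M {\<omega> \<in> space M. ennreal l < X n \<omega>} < \<epsilon>) sequentially"
proof -
  define B where "B j = {\<omega> \<in> space M. of_nat j < Y \<omega>}" for j :: nat
  have B [measurable]: "B j \<in> sets M" for j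
    unfolding B_def by measurable
  have "(\<lambda>j. emeasure M (B j)) \<longlonglongrightarrow> emeasure M (\<Inter>j. B j)"
  proof (rule Lim_emeasure_decseq)
    show "decseq B"
      by (rule decseq_SucI) (auto simp: B_def intro: le_less_trans[OF of_nat_mono[OF le_SucI[OF order_refl]]])
  qed (auto simp: emeasure_eq_measure)
  also have "emeasure M (\<Inter>j. B j) = 0"
  proof -
    have "AE \<omega> in M. \<omega> \<notin> (\<Inter>j. B j)"
      using fin
    proof eventually_elim
      case (elim \<omega>)
      then obtain j where "Y \<omega> < of_nat j"
        using ennreal_Ex_less_of_nat[of "Y \<omega>"] by (auto simp: less_top)
      then have "\<omega> \<notin> B j" by (auto simp: B_def dest: less_asym)
      then show ?case by blast
    qed
    then show ?thesis
      by (subst (asm) AE_iff_measurable[of "\<Inter>j. B j"]) (auto simp: B_def)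
  qed
  finally have "eventually (\<lambda>j. emeasure M (B j) < \<epsilon>) sequentially"
    using \<epsilon> by (rule order_tendstoD(2))
  then obtain j where j: "emeasure M (B j) < \<epsilon>"
    by (auto simp: eventually_sequentially)
  define D where "D n = {\<omega> \<in> space M. \<exists>i\<in>{n..}. ennreal (real j + 1) < X i \<omega>}" for n
  have D [measurable]: "D n \<in> sets M" for n
    unfolding D_def by measurable
  have "(\<lambda>n. emeasure M (D n)) \<longlonglongrightarrow> emeasure M (\<Inter>n. D n)"
  proof (rule Lim_emeasure_decseq)
    show "decseq D"
      unfolding decseq_def D_def by force
  qed (auto simp: emeasure_eq_measure)
  moreover have "emeasure M (\<Inter>n. D n) \<le> emeasure M (B j)"
  proof (rule emeasure_mono_AE)
    show "AE \<omega> in M. \<omega> \<in> (\<Inter>n. D n) \<longrightarrow> \<omega> \<in> B j"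
      using lim AE_space
    proof eventually_elim
      case (elim \<omega>)
      show ?case
      proof
        assume \<omega>: "\<omega> \<in> (\<Inter>n. D n)"
        have "of_nat j < Y \<omega>"
        proof (rule ccontr)
          assume "\<not> of_nat j < Y \<omega>"
          then have "Y \<omega> \<le> ennreal (real j)"
            by (simp add: not_less ennreal_of_nat_eq_real_of_nat)
          also have "\<dots> < ennreal (real j + 1)"
            by (rule ennreal_lessI) auto
          finally have "Y \<omega> < ennreal (real j + 1)" .
          then have "eventually (\<lambda>i. X i \<omega> < ennreal (real j + 1)) sequentially"
            using elim(1) by (rule order_tendstoD(2)[rotated])
          then obtain n where "\<And>i. n \<le> i \<Longrightarrow> X i \<omega> < ennreal (real j + 1)"
            by (auto simp: eventually_sequentially)
          moreover have "\<omega> \<in> D n" using \<omega> by blast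
          ultimately show False
            unfolding D_def by (force dest: less_asym)
        qed
        then show "\<omega> \<in> B j" using elim(2) by (simp add: B_def)
      qed
    qed
  qed simp
  ultimately have "eventually (\<lambda>n. emeasure M (D n) < \<epsilon>) sequentially"
    using j by (auto intro: order_tendstoD(2))
  then have "eventually (\<lambda>n. emeasure M {\<omega> \<in> space M. ennreal (real j + 1) < X n \<omega>} < \<epsilon>) sequentially"
  proof eventually_elim
    case (elim n)
    have "emeasure M {\<omega> \<in> space M. ennreal (real j + 1) < X n \<omega>} \<le> emeasure M (D n)"
      by (rule emeasure_mono) (auto simp: D_def)
    then show ?case using elim by (rule le_less_trans)
  qed
  then show ?thesis
    by (intro exI[of _ "real j + 1"]) simp
qed

theorem theorem3p5:
  fixes \<alpha> :: real and k :: nat and \<mu> :: "'a measure" and P :: "'w measure"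
    and M :: "'a set \<Rightarrow> 'w \<Rightarrow> ennreal"
    and N :: "(nat \<Rightarrow> 'a) set \<Rightarrow> 'w \<Rightarrow> ennreal"
    and f :: "(nat \<Rightarrow> 'a) \<Rightarrow> ennreal" and I :: "'w \<Rightarrow> ennreal"
  assumes "0 < \<alpha>" and "1 \<le> k"
    and "is_borel_space \<mu>" and "sigma_finite_measure \<mu>" and "emeasure \<mu> (space \<mu>) \<noteq> 0"
    and "frechet_rsm \<alpha> \<mu> P M"
    and "product_rsm \<alpha> k \<mu> P M N"
    and "f \<in> offdiag_functions k \<mu>"
    and "extremal_integral k \<mu> P N f I"
    and "AE \<omega> in P. I \<omega> < \<infinity>"
  shows "(\<integral>\<^sup>+ x. ennpowr (f x) \<alpha> \<partial>power_measure k \<mu>) < \<infinity>"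
proof -
  interpret P: prob_space P by (rule frechet_rsmD(1)[OF assms(6)])
  obtain fn Xn where I_meas: "I \<in> borel_measurable P"
    and simple: "\<And>n. simple_extremal_integral k \<mu> P N (fn n) (Xn n)"
    and fn_lim: "AE x in power_measure k \<mu>. (\<lambda>n. fn n x) \<longlonglongrightarrow> f x"
    and Xn_lim: "AE \<omega> in P. (\<lambda>n. Xn n \<omega>) \<longlonglongrightarrow> I \<omega>"
    using assms(9) unfolding extremal_integral_def by blast
  have Xn_meas: "Xn n \<in> borel_measurable P" for n
    using simple[of n] unfolding simple_extremal_integral_def by blast
  have fn_meas: "fn n \<in> borel_measurable (power_measure k \<mu>)" for n
  proof -
    obtain m :: nat and a :: "nat \<Rightarrow> real" and A where A: "\<forall>i<m. 0 < a i \<and> A i \<in> offdiag_sets k \<mu>"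
      and fn: "\<forall>x\<in>space (power_measure k \<mu>). fn n x = (\<Sum>i<m. ennreal (a i) * indicator (A i) x)"
      using simple[of n] unfolding simple_extremal_integral_def by blast
    have "(\<lambda>x. \<Sum>i<m. ennreal (a i) * indicator (A i) x) \<in> borel_measurable (power_measure k \<mu>)"
      using A offdiag_sets_measurable[OF assms(3), of k]
      by (intro borel_measurable_sum borel_measurable_times_ennreal borel_measurable_indicator) auto
    then show ?thesis
      using fn by (subst measurable_cong[of _ _ "\<lambda>x. \<Sum>i<m. ennreal (a i) * indicator (A i) x"]) auto
  qed
  have "0 < ennreal ((1 / 2) ^ k)"
    by (subst ennreal_less_zero_iff) simp
  then have "0 < ennreal (1 / 2) ^ k"
    by (subst ennreal_power) simp_all
  from P.tight_of_AE_tendsto_finite[OF Xn_meas I_meas Xn_lim assms(10) this]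
  obtain l where l: "0 \<le> l" and ev: "eventually (\<lambda>n. emeasure P {\<omega> \<in> space P. ennreal l < Xn n \<omega>} < ennreal (1 / 2) ^ k) sequentially"
    by blast
  define K :: ennreal where "K = (4 * of_nat k) ^ k * ennreal ((l + 1) powr \<alpha>)"
  have K: "K < \<infinity>"
    by (simp add: K_def ennreal_mult_less_top power_less_top_ennreal of_nat_less_top)
  from ev have "eventually (\<lambda>n. (\<integral>\<^sup>+x. ennpowr (fn n x) \<alpha> \<partial>power_measure k \<mu>) \<le> K) sequentially"
    unfolding K_def
    by eventually_elim (rule integral_simple_le[OF assms(1-4,6,7) simple l])
  then have limsup: "limsup (\<lambda>n. \<integral>\<^sup>+x. ennpowr (fn n x) \<alpha> \<partial>power_measure k \<mu>) \<le> K"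
    by (rule Limsup_bounded)
  have "(\<integral>\<^sup>+x. ennpowr (f x) \<alpha> \<partial>power_measure k \<mu>) \<le>
      (\<integral>\<^sup>+x. liminf (\<lambda>n. ennpowr (fn n x) \<alpha>) \<partial>power_measure k \<mu>)"
    using fn_lim by (intro nn_integral_mono_AE) (auto elim!: eventually_mono intro: ennpowr_le_liminf[OF assms(1)])
  also have "\<dots> \<le> liminf (\<lambda>n. \<integral>\<^sup>+x. ennpowr (fn n x) \<alpha> \<partial>power_measure k \<mu>)"
    using fn_meas by (intro nn_integral_liminf) (auto intro: measurable_compose[OF _ ennpowr_measurable])
  also have "\<dots> \<le> limsup (\<lambda>n. \<integral>\<^sup>+x. ennpowr (fn n x) \<alpha> \<partial>power_measure k \<mu>)"
    by (rule Liminf_le_Limsup) simp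
  also note limsup
  finally show ?thesis
    using K by (rule le_less_trans)
qed

end
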